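(* Let $\sigma$ be an irreducible incommensurable normalized multiscale substitution scheme in $\mathbb{R}^d$. Then every $\mathcal{T}\in\mathbb{X}_\sigma^F$ is almost repetitive, and any two tilings $\mathcal{T},\mathcal{T}'\in\mathbb{X}_\sigma^F$ are almost locally indistinguishable.
   Context: Schemes. A tile in $\mathbb{R}^d$ is a bounded Lebesgue measurable set $T$ of positive measure $\mathrm{vol}\,T$ whose boundary has measure zero. A tessellation of $U\subset\mathbb{R}^d$ is a collection of tiles with pairwise disjoint interiors and union $U$; it is called a patch if $U$ is bounded ($U$ is then the support of the patch) and a tiling if $U=\mathbb{R}^d$. A multiscale substitution scheme $\sigma=(\tau_\sigma,\varrho_\sigma)$ consists of a finite list of prototiles $\tau_\sigma=(T_1,\dots,T_n)$ and, for each $i$, a tessellation $\varrho_\sigma(T_i)$ of $T_i$ all of whose tiles are translates of rescaled prototiles $\alpha T_j$, with all $\alpha\in(0,1)$. A translate of $\alpha T_j$, $\alpha>0$, is a tile of type $j$ and scale $\alpha$. Standing assumptions: $\sigma$ is normalized, i.e. $\mathrm{vol}\,T_i=1$ for all $i$; distinct prototiles are geometrically different ($T_i$ is not a rescaled copy of $T_j$ for $i\ne j$), so the type of a tile is determined by the tile. Substitution semi-flow. For $t\ge 0$, $F_t(T_i)$ is the patch supported on $e^tT_i$ obtained by starting with $e^tT_i$ and repeatedly substituting (according to the rescaled rule $\varrho_\sigma$) every tile of volume $>1$, until all tiles have volume $\le 1$. $\sigma$ is irreducible if for all $i,j$ there is $t>0$ such that $F_t(T_i)$ contains a tile of type $j$.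 $\sigma$ is incommensurable if there are $i,j$ and $t_1,t_2>0$ with $t_1\notin\mathbb{Q}t_2$ such that $F_{t_1}(T_i)$ contains a tile of type $i$ and unit volume and $F_{t_2}(T_j)$ contains a tile of type $j$ and unit volume. Tiling space. Position each $T_i$ so that the origin is an interior point. Let $\mathscr{P}_\sigma=\{F_t(T_i): t\ge0,\ i=1,\dots,n\}$. Identify a patch or tiling with the closed set which is the union of the boundaries of its tiles. On closed subsets of $\mathbb{R}^d$ use the metric $D(A_1,A_2)=\inf(\{r>0: A_1\cap B(0,1/r)\subset A_2^{+r},\ A_2\cap B(0,1/r)\subset A_1^{+r}\}\cup\{1\})$, where $A^{+r}$ is the $r$-neighborhood of $A$ and $B(x,R)$ is the open Euclidean ball. The multiscale tiling space $\mathbb{X}^F_\sigma$ is the set of all tilings $\mathcal{T}$ of $\mathbb{R}^d$ such that every sub-patch of $\mathcal{T}$ is a limit, with respect to $D$, of translated sub-patches of elements of $\mathscr{P}_\sigma$. Almost repetitivity. A set in $\mathbb{R}^d$ is $R$-dense if it intersects every ball of radius $R$. $\mathcal{T}\in\mathbb{X}_\sigma^F$ is $\varepsilon$-repetitive if there is $R=R(\varepsilon)>0$ such that for every $y\in\mathbb{R}^d$ the set $\{x\in\mathbb{R}^d: D(\mathcal{T}-y,\mathcal{T}-x)<\varepsilon\}$ is $R$-dense; $\mathcal{T}$ is almost repetitive if it is $\varepsilon$-repetitive for every $\varepsilon>0$. Almost local indistinguishability. $\mathcal{T},\mathcal{T}'\in\mathbb{X}_\sigma^F$ are $\varepsilon$-locally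 indistinguishable if for every $y\in\mathbb{R}^d$ there are $x_1,x_2\in\mathbb{R}^d$ with $D(\mathcal{T}-y,\mathcal{T}'-x_1)<\varepsilon$ and $D(\mathcal{T}'-y,\mathcal{T}-x_2)<\varepsilon$; they are almost locally indistinguishable (ALI) if this holds for every $\varepsilon>0$.
   Formalization: Each tessellation of a prototile is assumed finite, and a patch counts as a limit of translated sub-patches only if both the unions of boundaries and the closed supports converge with respect to D; with unions of boundaries alone the claim fails. *)

theory Defs
  imports "HOL-Analysis.Analysis"
begin

section \<open>Tiles, tessellations, patches\<close>

definition tile :: "'a::euclidean_space set \<Rightarrow> bool" where
  "tile T \<longleftrightarrow> bounded T \<and> T \<in> sets lebesgue \<and> measure lebesgue T > 0 \<and> negligible (frontier T)"

text \<open>Tiles have nonempty interior, so disjointness of interiors rules out repetitions and a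
  collection of tiles can be taken to be a set.\<close>

definition tessellation :: "'a::euclidean_space set \<Rightarrow> 'a set set \<Rightarrow> bool" where
  "tessellation U P \<longleftrightarrow>
     (\<forall>S\<in>P. tile S) \<and> pairwise (\<lambda>S S'. interior S \<inter> interior S' = {}) P \<and> \<Union>P = U"

definition patch :: "'a::euclidean_space set set \<Rightarrow> bool" where
  "patch P \<longleftrightarrow> tessellation (\<Union>P) P \<and> bounded (\<Union>P)"

definition tiling :: "'a::euclidean_space set set \<Rightarrow> bool" where
  "tiling \<T> \<longleftrightarrow> tessellation UNIV \<T>"

definition sub_patch :: "'a::euclidean_space set set \<Rightarrow> 'a set set \<Rightarrow> bool" where
  "sub_patch Q P \<longleftrightarrow> patch Q \<and> Q \<subseteq> P"

definition similar_copy :: "real \<Rightarrow> 'a::euclidean_space \<Rightarrow> 'a set \<Rightarrow> 'a set" where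
  "similar_copy \<alpha> v S = (\<lambda>x. v + \<alpha> *\<^sub>R x) ` S"

definition translate :: "'a::euclidean_space \<Rightarrow> 'a set set \<Rightarrow> 'a set set" where
  "translate v P = (\<lambda>S. (+) v ` S) ` P"


section \<open>Multiscale substitution schemes\<close>

record 'a scheme =
  prototiles :: "'a set list"
  rule :: "nat \<Rightarrow> 'a set set"

definition num_types :: "'a scheme \<Rightarrow> nat" where
  "num_types \<sigma> = length (prototiles \<sigma>)"

definition prototile :: "'a scheme \<Rightarrow> nat \<Rightarrow> 'a set" where
  "prototile \<sigma> i = prototiles \<sigma> ! i"

text \<open>The tessellations \<open>rule \<sigma> i\<close> are finite. This is part of the notion of a substitution
  scheme (and needed for unions of boundaries to be closed): the half-open interval \<open>(0,1]\<close>,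
  cut into the infinitely many pieces \<open>(1/(k+1), 1/k]\<close>, has tilings in its tiling space with
  ever larger regions that consist of ever smaller tiles only.\<close>

definition substitution_scheme :: "'a::euclidean_space scheme \<Rightarrow> bool" where
  "substitution_scheme \<sigma> \<longleftrightarrow>
     (\<forall>i<num_types \<sigma>. tile (prototile \<sigma> i)) \<and>
     (\<forall>i<num_types \<sigma>. finite (rule \<sigma> i) \<and> tessellation (prototile \<sigma> i) (rule \<sigma> i) \<and>
        (\<forall>S\<in>rule \<sigma> i. \<exists>j<num_types \<sigma>. \<exists>\<alpha> v. 0 < \<alpha> \<and> \<alpha> < 1 \<and> S = similar_copy \<alpha> v (prototile \<sigma> j)))"

definition normalized :: "'a::euclidean_space scheme \<Rightarrow> bool" where
  "normalized \<sigma> \<longleftrightarrow> (\<forall>i<num_types \<sigma>. measure lebesgue (prototile \<sigma> i) = 1)"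

definition geometrically_distinct :: "'a::euclidean_space scheme \<Rightarrow> bool" where
  "geometrically_distinct \<sigma> \<longleftrightarrow>
     (\<forall>i<num_types \<sigma>. \<forall>j<num_types \<sigma>. i \<noteq> j \<longrightarrow>
        \<not> (\<exists>\<alpha> v. 0 < \<alpha> \<and> prototile \<sigma> i = similar_copy \<alpha> v (prototile \<sigma> j)))"

definition origin_interior :: "'a::euclidean_space scheme \<Rightarrow> bool" where
  "origin_interior \<sigma> \<longleftrightarrow> (\<forall>i<num_types \<sigma>. 0 \<in> interior (prototile \<sigma> i))"

definition of_type :: "'a::euclidean_space scheme \<Rightarrow> nat \<Rightarrow> 'a set \<Rightarrow> bool" where
  "of_type \<sigma> j S \<longleftrightarrow> (\<exists>\<alpha> v. 0 < \<alpha> \<and> S = similar_copy \<alpha> v (prototile \<sigma> j))"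


section \<open>The substitution semi-flow\<close>

text \<open>The rescaled rule applied to a tile. For geometrically distinct prototiles the type, scale
  and translation of \<open>S\<close> are determined by \<open>S\<close>, so the union below has at most one
  nonempty contribution.\<close>

definition substitute :: "'a::euclidean_space scheme \<Rightarrow> 'a set \<Rightarrow> 'a set set" where
  "substitute \<sigma> S =
     \<Union> {similar_copy \<alpha> v ` rule \<sigma> j | \<alpha> v j.
          j < num_types \<sigma> \<and> 0 < \<alpha> \<and> S = similar_copy \<alpha> v (prototile \<sigma> j)}"

text \<open>All tiles that show up at some stage of the substitution process started at
  \<open>e\<^sup>t T\<^sub>i\<close>; those of volume at most 1 are never substituted and form the final patch.\<close>

inductive_set flow_process :: "'a::euclidean_space scheme \<Rightarrow> real \<Rightarrow> nat \<Rightarrow> 'a set set"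
  for \<sigma> :: "'a::euclidean_space scheme" and t :: real and i :: nat where
  start: "similar_copy (exp t) 0 (prototile \<sigma> i) \<in> flow_process \<sigma> t i"
| subst: "S \<in> flow_process \<sigma> t i \<Longrightarrow> measure lebesgue S > 1 \<Longrightarrow> S' \<in> substitute \<sigma> S
            \<Longrightarrow> S' \<in> flow_process \<sigma> t i"

definition flow :: "'a::euclidean_space scheme \<Rightarrow> real \<Rightarrow> nat \<Rightarrow> 'a set set" where
  "flow \<sigma> t i = {S \<in> flow_process \<sigma> t i. measure lebesgue S \<le> 1}"

definition irreducible_scheme :: "'a::euclidean_space scheme \<Rightarrow> bool" where
  "irreducible_scheme \<sigma> \<longleftrightarrow>
     (\<forall>i<num_types \<sigma>. \<forall>j<num_types \<sigma>. \<exists>t>0. \<exists>S\<in>flow \<sigma> t i. of_type \<sigma> j S)"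

definition incommensurable :: "'a::euclidean_space scheme \<Rightarrow> bool" where
  "incommensurable \<sigma> \<longleftrightarrow>
     (\<exists>i<num_types \<sigma>. \<exists>j<num_types \<sigma>. \<exists>t1>0. \<exists>t2>0.
        \<not> (\<exists>q\<in>\<rat>. t1 = q * t2) \<and>
        (\<exists>S\<in>flow \<sigma> t1 i. of_type \<sigma> i S \<and> measure lebesgue S = 1) \<and>
        (\<exists>S\<in>flow \<sigma> t2 j. of_type \<sigma> j S \<and> measure lebesgue S = 1))"


section \<open>The tiling space\<close>

definition nbhd :: "real \<Rightarrow> 'a::euclidean_space set \<Rightarrow> 'a set" where
  "nbhd r A = {x. \<exists>a\<in>A. dist x a < r}"

definition D :: "'a::euclidean_space set \<Rightarrow> 'a set \<Rightarrow> real" where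
  "D A B = Inf ({r. r > 0 \<and> A \<inter> ball 0 (1 / r) \<subseteq> nbhd r B \<and> B \<inter> ball 0 (1 / r) \<subseteq> nbhd r A} \<union> {1})"

definition boundary :: "'a::euclidean_space set set \<Rightarrow> 'a set" where
  "boundary P = (\<Union>S\<in>P. frontier S)"

definition generating_patches :: "'a::euclidean_space scheme \<Rightarrow> 'a set set set" where
  "generating_patches \<sigma> = {flow \<sigma> t i | t i. 0 \<le> t \<and> i < num_types \<sigma>}"

text \<open>Tilings and patches are compared through their unions of boundaries, but for patches this
  closed set does not determine the patch: a tile \<open>A\<close> surrounded by other tiles of a patch can
  be removed without changing the union of the boundaries. A patch is therefore considered
  together with its support, and convergence with respect to \<open>D\<close> is required of both closed sets.
  (For tilings the support is the whole space and contributes nothing.) If the supports were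
  ignored, the tiling space could contain tilings with a configuration of tiles that
  occurs in no \<open>flow \<sigma> t i\<close>, each of its sub-patches having the same union of boundaries as a
  sub-patch in which a surrounded tile is missing, and such tilings need not be almost
  repetitive.\<close>

definition patch_limit :: "(nat \<Rightarrow> 'a::euclidean_space set set) \<Rightarrow> 'a set set \<Rightarrow> bool" where
  "patch_limit Q P \<longleftrightarrow>
     (\<lambda>k. D (boundary (Q k)) (boundary P)) \<longlonglongrightarrow> 0 \<and>
     (\<lambda>k. D (closure (\<Union>(Q k))) (closure (\<Union>P))) \<longlonglongrightarrow> 0"

definition tiling_space :: "'a::euclidean_space scheme \<Rightarrow> 'a set set set" where
  "tiling_space \<sigma> =
     {\<T>. tiling \<T> \<and>
        (\<forall>P. sub_patch P \<T> \<longrightarrow>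
           (\<exists>Q v. (\<forall>k. \<exists>G\<in>generating_patches \<sigma>. sub_patch (Q k) G) \<and>
                  patch_limit (\<lambda>k. translate (v k) (Q k)) P))}"


section \<open>Almost repetitivity and almost local indistinguishability\<close>

definition tiling_dist :: "'a::euclidean_space set set \<Rightarrow> 'a set set \<Rightarrow> real" where
  "tiling_dist \<T> \<T>' = D (boundary \<T>) (boundary \<T>')"

definition dense_at_radius :: "real \<Rightarrow> 'a::euclidean_space set \<Rightarrow> bool" where
  "dense_at_radius R E \<longleftrightarrow> (\<forall>z. E \<inter> ball z R \<noteq> {})"

definition eps_repetitive :: "real \<Rightarrow> 'a::euclidean_space set set \<Rightarrow> bool" where
  "eps_repetitive \<epsilon> \<T> \<longleftrightarrow>
     (\<exists>R>0. \<forall>y. dense_at_radius R {x. tiling_dist (translate (- y) \<T>) (translate (- x) \<T>) < \<epsilon>})"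

definition almost_repetitive :: "'a::euclidean_space set set \<Rightarrow> bool" where
  "almost_repetitive \<T> \<longleftrightarrow> (\<forall>\<epsilon>>0. eps_repetitive \<epsilon> \<T>)"

definition eps_locally_indistinguishable ::
  "real \<Rightarrow> 'a::euclidean_space set set \<Rightarrow> 'a set set \<Rightarrow> bool" where
  "eps_locally_indistinguishable \<epsilon> \<T> \<T>' \<longleftrightarrow>
     (\<forall>y. \<exists>x1 x2. tiling_dist (translate (- y) \<T>) (translate (- x1) \<T>') < \<epsilon> \<and>
                  tiling_dist (translate (- y) \<T>') (translate (- x2) \<T>) < \<epsilon>)"

definition almost_locally_indistinguishable ::
  "'a::euclidean_space set set \<Rightarrow> 'a set set \<Rightarrow> bool" where
  "almost_locally_indistinguishable \<T> \<T>' \<longleftrightarrow>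
     (\<forall>\<epsilon>>0. eps_locally_indistinguishable \<epsilon> \<T> \<T>')"

end

theory Submission
  imports Defs
begin

text \<open>Everything follows from one uniform statement: for each \<open>\<epsilon>\<close> there is a radius \<open>R\<close> such that, for any
two tilings of the tiling space, what is seen around any point of the first is seen up to \<open>\<epsilon>\<close> inside
every ball of radius \<open>R\<close> of the second (\<open>uniform_cross_recurrence\<close>). Taking both tilings equal gives
almost repetitivity, and taking them in both orders gives almost local indistinguishability.

Only unions of boundaries are ever compared, and around a point they take finitely many shapes up
to a given precision: a bounded region is described, up to that precision, by the points of a finite
net that are close to the set (\<open>finitely_many_views\<close>). A tiling of the tiling space looks locally like
some generating patch (\<open>tiling_agrees_with_flow\<close>), so finitely many patterns, each taken from the
interior of some \<open>F\<^sub>t(T\<^sub>i)\<close>, represent everything that can be seen in any tiling. It remains to find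
a fixed such pattern in every sufficiently large supertile \<open>e\<^sup>s T\<^sub>j\<close>
(\<open>pattern_occurs_in_large_tiles\<close>): every large ball of the second tiling looks like a ball of a
generating patch, which contains such a supertile.

A supertile \<open>e\<^sup>s T\<^sub>j\<close> contains translates of \<open>e\<^bsup>s-l\<^esup> T\<^sub>i\<close>, where \<open>l\<close> ranges over the lengths of walks
from \<open>j\<close> to \<open>i\<close> in the graph whose edges are the substituted tiles, an edge of ratio \<open>\<alpha>\<close> having length
\<open>- ln \<alpha>\<close>. Two closed walks with incommensurable lengths, joined by irreducibility, make these
lengths eventually dense (\<open>walks_eventually_dense\<close>), so for large \<open>s\<close> the number \<open>s - l\<close> can be
put just below \<open>t\<close>. The patch \<open>F\<^sub>t(T\<^sub>i)\<close> depends on \<open>t\<close> continuously from the left, since slightly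
smaller scales lead to the same subdivisions (\<open>leaves_scale_left_continuous\<close>), and so the
subdivided supertile contains a copy of \<open>F\<^sub>t(T\<^sub>i)\<close> that is barely shrunk.

Two points need care because tiles are merely measurable sets. A tile could have thin
parts that reach into its neighbours and disturb their boundaries; the prototiles of a substitution
scheme cannot, because they lie in the closure of their interiors (\<open>prototile_regular\<close>). And a tile
of a tiling in the tiling space need not be a copy of a prototile, but it still contains a ball of
fixed size up to a null set, which makes tilings locally finite (\<open>finite_tiles_meeting_ball\<close>).\<close>

section \<open>Similar copies\<close>

lemma similar_copy_eq: "similar_copy \<alpha> v S = (+) v ` ((*\<^sub>R) \<alpha>) ` S"
  by (simp add: similar_copy_def image_image)

lemma similar_copy_compose:
  "similar_copy \<alpha> v (similar_copy \<beta> w S) = similar_copy (\<alpha> * \<beta>) (v + \<alpha> *\<^sub>R w) S"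
  by (simp add: similar_copy_def image_image scaleR_add_right add.assoc)

lemma similar_copy_id [simp]: "similar_copy 1 0 S = S"
  by (simp add: similar_copy_def)

lemma similar_copy_mono: "S \<subseteq> S' \<Longrightarrow> similar_copy \<alpha> v S \<subseteq> similar_copy \<alpha> v S'"
  by (auto simp: similar_copy_def)

lemma inj_similar_copy_map: "\<alpha> \<noteq> 0 \<Longrightarrow> inj (\<lambda>x::'a::real_vector. v + \<alpha> *\<^sub>R x)"
  by (auto simp: inj_on_def)

lemma similar_copy_inverse:
  assumes "\<alpha> > 0"
  shows "similar_copy (inverse \<alpha>) (- (inverse \<alpha> *\<^sub>R v)) (similar_copy \<alpha> v S) = S"
  using assms by (simp add: similar_copy_compose)

lemma interior_similar_copy:
  fixes S :: "'a::euclidean_space set"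
  assumes "\<alpha> > 0" shows "interior (similar_copy \<alpha> v S) = similar_copy \<alpha> v (interior S)"
proof -
  have "linear ((*\<^sub>R) \<alpha> :: 'a \<Rightarrow> 'a)" by (rule linear_scale_self)
  moreover have "inj ((*\<^sub>R) \<alpha> :: 'a \<Rightarrow> 'a)" using assms by (auto intro: injI)
  ultimately show ?thesis
    unfolding similar_copy_eq interior_translation
    by (simp only: interior_injective_linear_image)
qed

lemma closure_similar_copy:
  fixes S :: "'a::euclidean_space set"
  shows "closure (similar_copy \<alpha> v S) = similar_copy \<alpha> v (closure S)"
  unfolding similar_copy_eq closure_translation closure_scaleR ..

lemma frontier_similar_copy:
  fixes S :: "'a::euclidean_space set"
  assumes "\<alpha> > 0" shows "frontier (similar_copy \<alpha> v S) = similar_copy \<alpha> v (frontier S)"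
proof -
  have "inj (\<lambda>x::'a. v + \<alpha> *\<^sub>R x)" using assms by (simp add: inj_similar_copy_map)
  then show ?thesis
    unfolding frontier_def closure_similar_copy interior_similar_copy[OF assms]
    unfolding similar_copy_def by (rule image_set_diff[symmetric])
qed

lemma measure_similar_copy:
  fixes S :: "'a::euclidean_space set"
  assumes "\<alpha> > 0"
  shows "measure lebesgue (similar_copy \<alpha> v S) = \<alpha> ^ DIM('a) * measure lebesgue S"
  using measure_lebesgue_affine[of \<alpha> v S] assms by (simp add: similar_copy_def add.commute)

lemma ball_similar_copy:
  fixes v :: "'a::euclidean_space"
  assumes "\<alpha> > 0"
  shows "similar_copy \<alpha> v (ball x r) = ball (v + \<alpha> *\<^sub>R x) (\<alpha> * r)"
  using assms by (simp only: similar_copy_eq ball_scale ball_translation[symmetric]) simp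

lemma cball_similar_copy:
  fixes v :: "'a::euclidean_space"
  assumes "\<alpha> > 0"
  shows "similar_copy \<alpha> v (cball x r) = cball (v + \<alpha> *\<^sub>R x) (\<alpha> * r)"
  using assms by (simp only: similar_copy_eq cball_scale cball_translation[symmetric]) simp

lemma infdist_similar_copy_le:
  fixes X :: "'a::euclidean_space set"
  assumes "0 < \<alpha>" "X \<noteq> {}"
  shows "infdist (v + \<alpha> *\<^sub>R p) (similar_copy \<alpha> v X) \<le> \<alpha> * infdist p X"
proof -
  have "infdist (v + \<alpha> *\<^sub>R p) (similar_copy \<alpha> v X) / \<alpha> \<le> (INF x\<in>X. dist p x)"
  proof (rule cINF_greatest[OF assms(2)])
    fix x assume "x \<in> X"
    then have "infdist (v + \<alpha> *\<^sub>R p) (similar_copy \<alpha> v X) \<le> dist (v + \<alpha> *\<^sub>R p) (v + \<alpha> *\<^sub>R x)"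
      by (intro infdist_le) (auto simp: similar_copy_def)
    also have "\<dots> = \<alpha> * dist p x"
      using assms by (simp add: dist_norm flip: scaleR_diff_right)
    finally show "infdist (v + \<alpha> *\<^sub>R p) (similar_copy \<alpha> v X) / \<alpha> \<le> dist p x"
      using assms by (simp add: field_simps)
  qed
  then show ?thesis using assms by (simp add: infdist_def field_simps)
qed

text \<open>Iterating a nonzero translation that preserves the set would carry its points to infinity.\<close>

lemma bounded_translate_eq_imp_zero:
  fixes w :: "'a::real_normed_vector"
  assumes "bounded S" "S \<noteq> {}" "S = (+) w ` S"
  shows "w = 0"
proof (rule ccontr)
  assume "w \<noteq> 0"
  obtain x where x: "x \<in> S" using assms by auto
  have *: "x + real n *\<^sub>R w \<in> S" for n
  proof (induction n)
    case (Suc n)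
    then have "w + (x + real n *\<^sub>R w) \<in> S" using assms(3) by blast
    then show ?case by (simp add: scaleR_add_left algebra_simps)
  qed (use x in simp)
  obtain B where B: "\<And>y. y \<in> S \<Longrightarrow> norm y \<le> B" using assms(1) bounded_iff by blast
  obtain n :: nat where n: "real n * norm w > B + norm x"
    using \<open>w \<noteq> 0\<close> by (metis reals_Archimedean3 zero_less_norm_iff)
  have "real n * norm w = norm ((x + real n *\<^sub>R w) - x)" by simp
  also have "\<dots> \<le> norm (x + real n *\<^sub>R w) + norm x" by (rule norm_triangle_ineq4)
  finally show False using B[OF *[of n]] n by linarith
qed

section \<open>Eventually dense additive semigroups\<close>

text \<open>By incommensurability some \<open>g = n b - m a\<close> is positive and tiny. Replacing \<open>n\<close> summands \<open>c\<close> by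
\<open>c + b\<close> while dropping \<open>m\<close> summands \<open>a\<close> changes the value by exactly \<open>g\<close>. Starting from a sum with
enough copies of \<open>a\<close> and \<open>c\<close>, repeated exchanges fill a whole period of length \<open>a\<close> in steps of \<open>g\<close>.\<close>

lemma semigroup_eventually_dense:
  fixes a b c \<eta> :: real
  assumes a: "a > 0" and b: "b > 0" and irr: "b / a \<notin> \<rat>" and \<eta>: "\<eta> > 0"
  shows "\<exists>L. \<forall>x\<ge>L. \<exists>(p::nat) (q::nat) (r::nat). x \<le> p * a + q * c + r * (c + b) \<and>
            p * a + q * c + r * (c + b) < x + \<eta>"
proof -
  \<comment> \<open>Kronecker approximation aimed at \<open>\<epsilon>\<close> with error below \<open>\<epsilon>\<close> yields the required sign of \<open>g\<close>; the bound \<open>1/4\<close> keeps \<open>h\<close> nonnegative.\<close>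
  define \<epsilon> where "\<epsilon> = min (1/4) (\<eta> / a / 4)"
  have e: "\<epsilon> > 0" using a \<eta> by (simp add: \<epsilon>_def)
  obtain h k :: int where k: "k > 0" and hk: "\<bar>of_int k * (b / a) - of_int h - \<epsilon>\<bar> < \<epsilon>"
    using sequence_of_fractional_parts_is_dense[OF irr e] by metis
  have "of_int k * (b / a) > 0" using k a b by simp
  moreover have "\<epsilon> \<le> 1/4" by (simp add: \<epsilon>_def)
  ultimately have "real_of_int h > -1" using hk by linarith
  then have h: "h \<ge> 0" by linarith
  define m where "m = nat h"
  define n where "n = nat k"
  define g where "g = real n * b - real m * a"
  have mk: "real m = of_int h" "real n = of_int k" using h k by (auto simp: m_def n_def)
  define s where "s = of_int k * (b / a) - of_int h"
  have s: "\<bar>s - \<epsilon>\<bar> < \<epsilon>" using hk by (simp only: s_def)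
  have ga: "g = a * s" using a by (simp add: g_def s_def mk field_simps)
  have g0: "g > 0" using s a unfolding ga by (intro mult_pos_pos) linarith+
  have "s < 2 * \<epsilon>" using s by linarith
  then have "g < a * (2 * \<epsilon>)" unfolding ga using a by (intro mult_strict_left_mono)
  also have "\<dots> \<le> a * (\<eta> / a / 2)" using a by (intro mult_left_mono) (auto simp: \<epsilon>_def)
  also have "\<dots> < \<eta>" using a \<eta> by simp
  finally have g1: "g < \<eta>" .
  \<comment> \<open>\<open>K\<close> exchanges suffice to cross a period; they consume up to \<open>K * n\<close> summands \<open>c\<close> and \<open>K * m\<close> summands \<open>a\<close>.\<close>
  define K where "K = nat \<lceil>a / g\<rceil> + 1"
  define N where "N = K * n"
  show ?thesis
  proof (intro exI[of _ "real N * c + real (K * m) * a"] allI impI)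
    fix x assume x: "x \<ge> real N * c + real (K * m) * a"
    define y where "y = x - real N * c"
    have y0: "y \<ge> real (K * m) * a" using x by (simp add: y_def)
    then have y00: "y \<ge> 0" using a by (meson le_less_trans linorder_not_le mult_nonneg_nonneg of_nat_0_le_iff less_imp_le)
    define p where "p = nat \<lfloor>y / a\<rfloor>"
    have p: "real p = of_int \<lfloor>y / a\<rfloor>" using y00 a by (simp add: p_def)
    have pl: "real p * a \<le> y" using a by (simp add: p) (metis mult_imp_le_div_pos of_int_floor_le pos_le_divide_eq)
    have pu: "y < real p * a + a"
    proof -
      have "y / a < real p + 1" unfolding p by linarith
      then show ?thesis using a by (simp add: field_simps)
    qed
    have pK: "p \<ge> K * m"
    proof -
      have "real (K * m) \<le> y / a" using y0 a by (simp add: field_simps)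
      then show ?thesis unfolding p_def by (metis floor_mono floor_of_nat nat_int nat_mono)
    qed
    define k' where "k' = nat \<lceil>(y - real p * a) / g\<rceil>"
    have k'0: "real k' = of_int \<lceil>(y - real p * a) / g\<rceil>"
      using pl g0 by (simp add: k'_def ceiling_le_iff le_ceiling_iff)
    have k'1: "y - real p * a \<le> k' * g"
    proof -
      have "(y - real p * a) / g \<le> real k'" unfolding k'0 by linarith
      then show ?thesis using g0 by (simp add: field_simps)
    qed
    have k'2: "k' * g < y - real p * a + g"
    proof -
      have "real k' < (y - real p * a) / g + 1" unfolding k'0 by linarith
      then show ?thesis using g0 by (simp add: field_simps)
    qed
    have k'K: "k' \<le> K"
    proof -
      have "(y - real p * a) / g \<le> a / g" using pu g0 by (intro divide_right_mono) auto
      then have "\<lceil>(y - real p * a) / g\<rceil> \<le> \<lceil>a / g\<rceil>" by (rule ceiling_mono)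
      then show ?thesis unfolding k'_def K_def by linarith
    qed
    have k'm: "k' * m \<le> p" using k'K pK by (meson le_trans mult_le_mono1)
    have "real (p - k' * m) * a + real (N - k' * n) * c + real (k' * n) * (c + b)
         = real p * a + real N * c + real k' * g"
    proof -
      have "k' * n \<le> N" using k'K by (simp add: N_def)
      then show ?thesis using k'm by (simp add: of_nat_diff g_def algebra_simps)
    qed
    then show "\<exists>(p::nat) (q::nat) (r::nat). x \<le> p * a + q * c + r * (c + b) \<and>
            p * a + q * c + r * (c + b) < x + \<eta>"
      using k'1 k'2 g1 y_def
      by (intro exI[of _ "p - k' * m"] exI[of _ "N - k' * n"] exI[of _ "k' * n"]) linarith
  qed
qed

section \<open>The substitution process\<close>

definition is_copy :: "'a::euclidean_space scheme \<Rightarrow> real \<Rightarrow> 'a set \<Rightarrow> bool" where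
  "is_copy \<sigma> \<mu> S \<longleftrightarrow> 0 < \<mu> \<and> (\<exists>j<num_types \<sigma>. \<exists>v. S = similar_copy \<mu> v (prototile \<sigma> j))"

definition divides :: "'a::euclidean_space scheme \<Rightarrow> 'a set \<Rightarrow> 'a set \<Rightarrow> bool" where
  "divides \<sigma> S S' \<longleftrightarrow> measure lebesgue S > 1 \<and> S' \<in> substitute \<sigma> S"

text \<open>The end result of substituting an arbitrary tile, not only \<open>e\<^sup>t T\<^sub>i\<close>: it is applied below to the
supertiles that occur inside a patch.\<close>

definition leaves :: "'a::euclidean_space scheme \<Rightarrow> 'a set \<Rightarrow> 'a set set" where
  "leaves \<sigma> S = {S'. (divides \<sigma>)\<^sup>*\<^sup>* S S' \<and> measure lebesgue S' \<le> 1}"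

lemma flow_eq_leaves: "flow \<sigma> t i = leaves \<sigma> (similar_copy (exp t) 0 (prototile \<sigma> i))"
proof -
  have "S \<in> flow_process \<sigma> t i \<longleftrightarrow> (divides \<sigma>)\<^sup>*\<^sup>* (similar_copy (exp t) 0 (prototile \<sigma> i)) S" for S
  proof
    assume "S \<in> flow_process \<sigma> t i"
    then show "(divides \<sigma>)\<^sup>*\<^sup>* (similar_copy (exp t) 0 (prototile \<sigma> i)) S"
    proof induction
      case (subst S S')
      then have "divides \<sigma> S S'" by (simp add: divides_def)
      then show ?case using subst by (meson rtranclp.rtrancl_into_rtrancl)
    qed simp
  next
    assume "(divides \<sigma>)\<^sup>*\<^sup>* (similar_copy (exp t) 0 (prototile \<sigma> i)) S"
    then show "S \<in> flow_process \<sigma> t i"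
    proof induction
      case base
      show ?case by (rule flow_process.start)
    next
      case (step S S')
      then show ?case by (auto simp: divides_def intro: flow_process.subst)
    qed
  qed
  then show ?thesis by (simp add: flow_def leaves_def)
qed

lemma leaves_small:
  assumes "measure lebesgue S \<le> 1"
  shows "leaves \<sigma> S = {S}"
proof -
  have "S' = S" if "(divides \<sigma>)\<^sup>*\<^sup>* S S'" for S'
    using that assms by (cases rule: converse_rtranclpE) (auto simp: divides_def)
  then show ?thesis using assms by (auto simp: leaves_def)
qed

lemma leaves_large:
  assumes "measure lebesgue S > 1"
  shows "leaves \<sigma> S = (\<Union>S'\<in>substitute \<sigma> S. leaves \<sigma> S')"
proof (intro subset_antisym subsetI)
  fix q assume q: "q \<in> leaves \<sigma> S"
  then have "(divides \<sigma>)\<^sup>*\<^sup>* S q" "S \<noteq> q" using assms by (auto simp: leaves_def)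
  then obtain S' where "divides \<sigma> S S'" "(divides \<sigma>)\<^sup>*\<^sup>* S' q"
    by (cases rule: converse_rtranclpE) auto
  then show "q \<in> (\<Union>S'\<in>substitute \<sigma> S. leaves \<sigma> S')"
    using q by (auto simp: leaves_def divides_def)
next
  fix q assume "q \<in> (\<Union>S'\<in>substitute \<sigma> S. leaves \<sigma> S')"
  then obtain S' where "S' \<in> substitute \<sigma> S" "(divides \<sigma>)\<^sup>*\<^sup>* S' q" "measure lebesgue q \<le> 1"
    by (auto simp: leaves_def)
  moreover have "divides \<sigma> S S'" using calculation assms by (simp add: divides_def)
  ultimately show "q \<in> leaves \<sigma> S"
    by (auto simp: leaves_def intro: converse_rtranclp_into_rtranclp)
qed

lemma leaves_mono: "(divides \<sigma>)\<^sup>*\<^sup>* S S' \<Longrightarrow> leaves \<sigma> S' \<subseteq> leaves \<sigma> S"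
  by (auto simp: leaves_def)

lemma substitute_iff:
  "X \<in> substitute \<sigma> S \<longleftrightarrow> (\<exists>\<alpha> v j. \<exists>Y\<in>rule \<sigma> j. j < num_types \<sigma> \<and> 0 < \<alpha> \<and>
     S = similar_copy \<alpha> v (prototile \<sigma> j) \<and> X = similar_copy \<alpha> v Y)"
  unfolding substitute_def by blast

text \<open>The definition of \<^const>\<open>substitute\<close> ranges over all presentations of the tile as a copy of a
prototile, and a similarity maps them bijectively to the presentations of the image.\<close>

lemma substitute_similar_copy:
  assumes c: "c > 0"
  shows "substitute \<sigma> (similar_copy c w S) = similar_copy c w ` substitute \<sigma> S"
proof -
  have inv: "similar_copy c w (similar_copy (inverse c) (- (inverse c *\<^sub>R w)) X) = X" for X
    using c by (simp add: similar_copy_compose)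
  have eq: "similar_copy c w S = X \<longleftrightarrow> S = similar_copy (inverse c) (- (inverse c *\<^sub>R w)) X" for X
    using similar_copy_inverse[OF c, of w S] inv[of X] by auto
  show ?thesis
  proof (intro subset_antisym subsetI)
    fix X assume "X \<in> substitute \<sigma> (similar_copy c w S)"
    then obtain \<alpha> v j Y where *: "j < num_types \<sigma>" "0 < \<alpha>"
        "similar_copy c w S = similar_copy \<alpha> v (prototile \<sigma> j)"
      and Y: "Y \<in> rule \<sigma> j" "X = similar_copy \<alpha> v Y"
      unfolding substitute_iff by blast
    define Z where "Z = similar_copy (inverse c) (- (inverse c *\<^sub>R w)) X"
    have "S = similar_copy (inverse c * \<alpha>) (- (inverse c *\<^sub>R w) + inverse c *\<^sub>R v) (prototile \<sigma> j)"
      using *(3) unfolding eq similar_copy_compose .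
    moreover have "Z = similar_copy (inverse c * \<alpha>) (- (inverse c *\<^sub>R w) + inverse c *\<^sub>R v) Y"
      unfolding Z_def Y similar_copy_compose ..
    ultimately have "Z \<in> substitute \<sigma> S"
      unfolding substitute_iff using * Y c by (metis mult_pos_pos positive_imp_inverse_positive)
    moreover have "X = similar_copy c w Z" by (simp add: Z_def inv)
    ultimately show "X \<in> similar_copy c w ` substitute \<sigma> S" by auto
  next
    fix X assume "X \<in> similar_copy c w ` substitute \<sigma> S"
    then obtain Z where Z: "Z \<in> substitute \<sigma> S" "X = similar_copy c w Z" by blast
    then obtain \<alpha> v j Y where *: "j < num_types \<sigma>" "0 < \<alpha>" "S = similar_copy \<alpha> v (prototile \<sigma> j)"
      "Y \<in> rule \<sigma> j" "Z = similar_copy \<alpha> v Y"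
      unfolding substitute_iff by blast
    with Z have "similar_copy c w S = similar_copy (c * \<alpha>) (w + c *\<^sub>R v) (prototile \<sigma> j)"
      "X = similar_copy (c * \<alpha>) (w + c *\<^sub>R v) Y" by (simp_all add: similar_copy_compose)
    then show "X \<in> substitute \<sigma> (similar_copy c w S)"
      unfolding substitute_iff using * c by (metis mult_pos_pos)
  qed
qed

section \<open>Copies of prototiles and their descendants\<close>

text \<open>A scheme together with uniform bounds: the ratios of all substitution rules lie in \<open>[a, b]\<close>, and
\<open>\<rho>\<close> and \<open>M\<close> bound the prototiles from inside and outside. Hence every tile of a generating patch
contains a ball of radius \<open>a * \<rho>\<close> and lies in a ball of radius \<open>M\<close>.\<close>

locale bounded_scheme =
  fixes \<sigma> :: "'a::euclidean_space scheme" and a b M \<rho> :: real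
  assumes scheme: "substitution_scheme \<sigma>"
    and normalized: "normalized \<sigma>"
    and distinct: "geometrically_distinct \<sigma>"
    and a_pos: "0 < a" and a_less: "a < 1" and b_pos: "0 < b" and b_less: "b < 1"
    and \<rho>_pos: "0 < \<rho>" and M_pos: "0 < M"
    and rule_copy: "i < num_types \<sigma> \<Longrightarrow> S \<in> rule \<sigma> i \<Longrightarrow>
      \<exists>j<num_types \<sigma>. \<exists>\<alpha> v. a \<le> \<alpha> \<and> \<alpha> \<le> b \<and> S = similar_copy \<alpha> v (prototile \<sigma> j)"
    and prototile_bound: "i < num_types \<sigma> \<Longrightarrow> prototile \<sigma> i \<subseteq> cball 0 M"
    and prototile_ball: "i < num_types \<sigma> \<Longrightarrow> ball 0 \<rho> \<subseteq> prototile \<sigma> i"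
begin

lemma tile_prototile: "i < num_types \<sigma> \<Longrightarrow> tile (prototile \<sigma> i)"
  using scheme by (simp add: substitution_scheme_def)

lemma measure_prototile: "i < num_types \<sigma> \<Longrightarrow> measure lebesgue (prototile \<sigma> i) = 1"
  using normalized by (simp add: normalized_def)

lemma measure_copy: "is_copy \<sigma> \<mu> S \<Longrightarrow> measure lebesgue S = \<mu> ^ DIM('a)"
  by (auto simp: is_copy_def measure_similar_copy measure_prototile)

lemma measure_copy_le_1: "is_copy \<sigma> \<mu> S \<Longrightarrow> measure lebesgue S \<le> 1 \<longleftrightarrow> \<mu> \<le> 1"
  by (subst measure_copy) (auto simp: is_copy_def power_le_one_iff)

lemma measure_copy_gt_1: "is_copy \<sigma> \<mu> S \<Longrightarrow> measure lebesgue S > 1 \<longleftrightarrow> \<mu> > 1"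
  using measure_copy_le_1 by (metis linorder_not_le)

lemma is_copyI: "j < num_types \<sigma> \<Longrightarrow> 0 < \<mu> \<Longrightarrow> is_copy \<sigma> \<mu> (similar_copy \<mu> v (prototile \<sigma> j))"
  by (auto simp: is_copy_def)

text \<open>The type is determined by geometric distinctness, the scale by the volume, and the position
because no nonzero translation preserves a nonempty bounded set.\<close>

lemma copy_unique:
  assumes "i < num_types \<sigma>" "j < num_types \<sigma>" "0 < \<alpha>" "0 < \<beta>"
    and eq: "similar_copy \<alpha> v (prototile \<sigma> i) = similar_copy \<beta> w (prototile \<sigma> j)"
  shows "i = j \<and> \<alpha> = \<beta> \<and> v = w"
proof -
  have "prototile \<sigma> i = similar_copy (inverse \<alpha>) (- (inverse \<alpha> *\<^sub>R v)) (similar_copy \<alpha> v (prototile \<sigma> i))"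
    using similar_copy_inverse[OF \<open>0 < \<alpha>\<close>] by metis
  also have "\<dots> = similar_copy (inverse \<alpha> * \<beta>) (- (inverse \<alpha> *\<^sub>R v) + inverse \<alpha> *\<^sub>R w) (prototile \<sigma> j)"
    unfolding eq similar_copy_compose ..
  finally have *: "prototile \<sigma> i
      = similar_copy (inverse \<alpha> * \<beta>) (- (inverse \<alpha> *\<^sub>R v) + inverse \<alpha> *\<^sub>R w) (prototile \<sigma> j)" .
  moreover have pos: "inverse \<alpha> * \<beta> > 0" using assms by simp
  ultimately have ij: "i = j"
    using distinct assms unfolding geometrically_distinct_def by blast
  have "(inverse \<alpha> * \<beta>) ^ DIM('a) = 1"
    using arg_cong[OF *, of "measure lebesgue"] pos assms
    by (simp add: measure_similar_copy measure_prototile)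
  then have "inverse \<alpha> * \<beta> = 1"
    using pos power_eq_imp_eq_base[of "inverse \<alpha> * \<beta>" "DIM('a)" 1] by simp
  then have ab: "\<alpha> = \<beta>" using assms by (simp add: field_simps)
  have "- (inverse \<alpha> *\<^sub>R v) + inverse \<alpha> *\<^sub>R w = 0"
  proof (rule bounded_translate_eq_imp_zero)
    show "bounded (prototile \<sigma> i)" using tile_prototile assms by (auto simp: tile_def)
    show "prototile \<sigma> i \<noteq> {}" using measure_prototile assms by fastforce
    show "prototile \<sigma> i = (+) (- (inverse \<alpha> *\<^sub>R v) + inverse \<alpha> *\<^sub>R w) ` prototile \<sigma> i"
      using * ij \<open>inverse \<alpha> * \<beta> = 1\<close> by (simp add: similar_copy_def)
  qed
  then have "inverse \<alpha> *\<^sub>R v = inverse \<alpha> *\<^sub>R w"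
    unfolding add_eq_0_iff by (simp only: minus_minus)
  then have "v = w" by (rule scaleR_left_imp_eq[rotated]) (use assms in simp)
  then show ?thesis using ij ab by simp
qed

lemma substitute_copy:
  assumes "j < num_types \<sigma>" "0 < \<alpha>"
  shows "substitute \<sigma> (similar_copy \<alpha> v (prototile \<sigma> j)) = similar_copy \<alpha> v ` rule \<sigma> j"
proof (intro subset_antisym subsetI)
  fix X assume "X \<in> substitute \<sigma> (similar_copy \<alpha> v (prototile \<sigma> j))"
  then obtain \<beta> w i Y where "Y \<in> rule \<sigma> i" "i < num_types \<sigma>" "0 < \<beta>"
    "similar_copy \<alpha> v (prototile \<sigma> j) = similar_copy \<beta> w (prototile \<sigma> i)" "X = similar_copy \<beta> w Y"
    unfolding substitute_iff by blast
  then show "X \<in> similar_copy \<alpha> v ` rule \<sigma> j" using copy_unique assms by blast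
next
  fix X assume "X \<in> similar_copy \<alpha> v ` rule \<sigma> j"
  then show "X \<in> substitute \<sigma> (similar_copy \<alpha> v (prototile \<sigma> j))"
    unfolding substitute_iff using assms by blast
qed

lemma substitute_child:
  assumes "is_copy \<sigma> \<mu> S" "S' \<in> substitute \<sigma> S"
  shows "\<exists>\<nu>. a * \<mu> \<le> \<nu> \<and> \<nu> \<le> b * \<mu> \<and> is_copy \<sigma> \<nu> S'" "S' \<subseteq> S"
proof -
  obtain j v where j: "j < num_types \<sigma>" "0 < \<mu>" "S = similar_copy \<mu> v (prototile \<sigma> j)"
    using assms by (auto simp: is_copy_def)
  then obtain X where X: "X \<in> rule \<sigma> j" "S' = similar_copy \<mu> v X"
    using assms substitute_copy by auto
  obtain k \<alpha> w where k: "k < num_types \<sigma>" "a \<le> \<alpha>" "\<alpha> \<le> b" "X = similar_copy \<alpha> w (prototile \<sigma> k)"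
    using rule_copy j X by blast
  have "0 < \<alpha>" using k a_pos by linarith
  then have "is_copy \<sigma> (\<mu> * \<alpha>) S'"
    unfolding X k similar_copy_compose using j k by (intro is_copyI) auto
  moreover have "a * \<mu> \<le> \<mu> * \<alpha>" "\<mu> * \<alpha> \<le> b * \<mu>" using k j by (auto simp: mult.commute)
  ultimately show "\<exists>\<nu>. a * \<mu> \<le> \<nu> \<and> \<nu> \<le> b * \<mu> \<and> is_copy \<sigma> \<nu> S'" by blast
  have "X \<subseteq> prototile \<sigma> j"
    using scheme j X unfolding substitution_scheme_def tessellation_def by blast
  then show "S' \<subseteq> S" unfolding X j by (rule similar_copy_mono)
qed

lemma finite_substitute:
  assumes "is_copy \<sigma> \<mu> S" shows "finite (substitute \<sigma> S)"
proof -
  obtain j v where j: "j < num_types \<sigma>" "0 < \<mu>" "S = similar_copy \<mu> v (prototile \<sigma> j)"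
    using assms by (auto simp: is_copy_def)
  then have "finite (rule \<sigma> j)" using scheme by (simp add: substitution_scheme_def)
  then show ?thesis using j substitute_copy by simp
qed

lemma substitute_disjoint:
  assumes "is_copy \<sigma> \<mu> S" "X \<in> substitute \<sigma> S" "Y \<in> substitute \<sigma> S" "X \<noteq> Y"
  shows "interior X \<inter> interior Y = {}"
proof -
  obtain j v where j: "j < num_types \<sigma>" "0 < \<mu>" "S = similar_copy \<mu> v (prototile \<sigma> j)"
    using assms by (auto simp: is_copy_def)
  then obtain X' Y' where X: "X' \<in> rule \<sigma> j" "X = similar_copy \<mu> v X'"
    and Y: "Y' \<in> rule \<sigma> j" "Y = similar_copy \<mu> v Y'"
    using assms substitute_copy by auto
  have "interior X' \<inter> interior Y' = {}"
    using scheme j X Y \<open>X \<noteq> Y\<close> unfolding substitution_scheme_def tessellation_def pairwise_def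
    by metis
  then show ?thesis
    unfolding X(2) Y(2) interior_similar_copy[OF j(2)]
    using j(2) by (auto simp: similar_copy_def)
qed

lemma descendant_copy:
  assumes "(divides \<sigma>)\<^sup>*\<^sup>* S S'" "is_copy \<sigma> \<mu> S"
  shows "\<exists>\<nu>. is_copy \<sigma> \<nu> S'" "S' \<subseteq> S"
proof -
  have "(\<exists>\<nu>. is_copy \<sigma> \<nu> S') \<and> S' \<subseteq> S"
    using assms
  proof induction
    case (step X Y)
    then show ?case using substitute_child unfolding divides_def by blast
  qed auto
  then show "\<exists>\<nu>. is_copy \<sigma> \<nu> S'" "S' \<subseteq> S" by auto
qed

text \<open>Only tiles of scale above 1 are divided, so a child never has scale below \<open>a\<close>.\<close>

lemma leaf_copy:
  assumes "q \<in> leaves \<sigma> S" "is_copy \<sigma> \<mu> S" "1 \<le> \<mu>"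
  shows "\<exists>\<nu>. a \<le> \<nu> \<and> \<nu> \<le> 1 \<and> is_copy \<sigma> \<nu> q"
proof -
  have "(divides \<sigma>)\<^sup>*\<^sup>* S q" using assms by (simp add: leaves_def)
  then have "\<exists>\<nu>. a \<le> \<nu> \<and> is_copy \<sigma> \<nu> q"
  proof induction
    case base
    then show ?case using assms a_less by (intro exI[of _ \<mu>]) auto
  next
    case (step X Y)
    then obtain \<nu> where \<nu>: "is_copy \<sigma> \<nu> X" by blast
    then have "\<nu> > 1" using step measure_copy_gt_1 unfolding divides_def by blast
    obtain \<eta> where "a * \<nu> \<le> \<eta>" "is_copy \<sigma> \<eta> Y"
      using substitute_child[OF \<nu>] step unfolding divides_def by blast
    moreover have "a \<le> a * \<nu>" using \<open>\<nu> > 1\<close> a_pos by simp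
    ultimately show ?case by (meson order_trans)
  qed
  then show ?thesis using assms measure_copy_le_1 unfolding leaves_def by blast
qed

lemma copy_ball:
  assumes "is_copy \<sigma> \<nu> q" "a \<le> \<nu>" "\<nu> \<le> 1"
  shows "\<exists>w. ball w (a * \<rho>) \<subseteq> interior q \<and> q \<subseteq> cball w M"
proof -
  obtain j v where j: "j < num_types \<sigma>" "0 < \<nu>" "q = similar_copy \<nu> v (prototile \<sigma> j)"
    using assms by (auto simp: is_copy_def)
  have "ball v (\<nu> * \<rho>) \<subseteq> q"
    using similar_copy_mono[OF prototile_ball[OF j(1)], of \<nu> v] j by (simp add: ball_similar_copy)
  moreover have "ball v (a * \<rho>) \<subseteq> ball v (\<nu> * \<rho>)"
    using assms \<rho>_pos by (intro subset_ball mult_right_mono) auto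
  ultimately have "ball v (a * \<rho>) \<subseteq> interior q" by (intro interior_maximal) auto
  moreover have "q \<subseteq> cball v (\<nu> * M)"
    using similar_copy_mono[OF prototile_bound[OF j(1)], of \<nu> v] j by (simp add: cball_similar_copy)
  moreover have "cball v (\<nu> * M) \<subseteq> cball v M"
    using assms M_pos by (intro subset_cball) (simp add: mult_le_cancel_right1)
  ultimately show ?thesis by blast
qed

text \<open>Each substitution shrinks scales by at least the factor \<open>b\<close>, so the process that divides tiles of
scale above 1 terminates.\<close>

lemma copy_induct [consumes 1, case_names small large]:
  assumes "is_copy \<sigma> \<mu> S"
    and small: "\<And>\<mu> S. is_copy \<sigma> \<mu> S \<Longrightarrow> \<mu> \<le> 1 \<Longrightarrow> P S"
    and large: "\<And>\<mu> S. is_copy \<sigma> \<mu> S \<Longrightarrow> \<mu> > 1 \<Longrightarrow> (\<And>S'. S' \<in> substitute \<sigma> S \<Longrightarrow> P S') \<Longrightarrow> P S"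
  shows "P S"
proof -
  have *: "is_copy \<sigma> \<mu> S \<Longrightarrow> \<mu> * b ^ m \<le> 1 \<Longrightarrow> P S" for m \<mu> S
  proof (induction m arbitrary: \<mu> S)
    case 0
    then show ?case using small by simp
  next
    case (Suc m)
    show ?case
    proof (cases "\<mu> \<le> 1")
      case False
      show ?thesis
      proof (rule large[OF Suc.prems(1)])
        fix S' assume "S' \<in> substitute \<sigma> S"
        then obtain \<nu> where \<nu>: "\<nu> \<le> b * \<mu>" "is_copy \<sigma> \<nu> S'" using substitute_child Suc by blast
        then have "\<nu> * b ^ m \<le> b * \<mu> * b ^ m" using b_pos by (intro mult_right_mono) auto
        also have "\<dots> \<le> 1" using Suc.prems(2) by (simp add: mult_ac)
        finally show "P S'" using Suc.IH \<nu> by blast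
      qed (use False in simp)
    qed (use small Suc in blast)
  qed
  have mu: "\<mu> > 0" using assms by (simp add: is_copy_def)
  obtain m where "b ^ m < 1 / \<mu>" using real_arch_pow_inv[of "1 / \<mu>" b] mu b_less by auto
  then show ?thesis using * assms(1) mu by (intro *[of \<mu> S m]) (auto simp: field_simps)
qed

lemma is_copy_scale_unique: "is_copy \<sigma> \<mu> S \<Longrightarrow> is_copy \<sigma> \<nu> S \<Longrightarrow> \<mu> = \<nu>"
  unfolding is_copy_def using copy_unique by metis

lemma is_copy_similar_copy:
  assumes "is_copy \<sigma> \<mu> S" "0 < \<theta>"
  shows "is_copy \<sigma> (\<theta> * \<mu>) (similar_copy \<theta> w S)"
proof -
  obtain j v where j: "j < num_types \<sigma>" "0 < \<mu>" "S = similar_copy \<mu> v (prototile \<sigma> j)"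
    using assms by (auto simp: is_copy_def)
  show ?thesis unfolding j similar_copy_compose using j assms by (intro is_copyI) auto
qed

section \<open>Regularity of the prototiles\<close>

lemma zero_in_interior_prototile: "i < num_types \<sigma> \<Longrightarrow> 0 \<in> interior (prototile \<sigma> i)"
  using prototile_ball \<rho>_pos by (meson centre_in_ball interiorI open_ball)

text \<open>Let \<open>m\<close> be the supremum of the distances of points of prototiles to the interiors of their
prototiles. Such a point lies in a tile of the substitution rule, whose interior is part of the
interior of the prototile. Measured in that tile the distance is scaled by at most \<open>b\<close>, so
\<open>m \<le> b m\<close> and \<open>m = 0\<close>.\<close>

lemma prototile_regular:
  assumes i: "i < num_types \<sigma>"
  shows "prototile \<sigma> i \<subseteq> closure (interior (prototile \<sigma> i))"
proof -
  define E where "E = {infdist p (interior (prototile \<sigma> j)) | j p. j < num_types \<sigma> \<and> p \<in> prototile \<sigma> j}"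
  have bound: "x \<le> M" if x: "x \<in> E" for x
  proof -
    obtain j p where j: "j < num_types \<sigma>" "p \<in> prototile \<sigma> j" "x = infdist p (interior (prototile \<sigma> j))"
      using x E_def by auto
    have "x \<le> dist p 0" unfolding j by (rule infdist_le[OF zero_in_interior_prototile[OF j(1)]])
    also have "\<dots> \<le> M" using prototile_bound[OF j(1)] j(2) by (auto simp: dist_commute)
    finally show ?thesis .
  qed
  have bdd: "bdd_above E" using bound by (rule bdd_aboveI)
  have contract: "x \<le> b * Sup E" if x: "x \<in> E" for x
  proof -
    obtain j p where j: "j < num_types \<sigma>" "p \<in> prototile \<sigma> j" "x = infdist p (interior (prototile \<sigma> j))"
      using x E_def by auto
    have tess: "tessellation (prototile \<sigma> j) (rule \<sigma> j)"
      using scheme j by (simp add: substitution_scheme_def)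
    then obtain S where S: "S \<in> rule \<sigma> j" "p \<in> S" "S \<subseteq> prototile \<sigma> j"
      using j unfolding tessellation_def by blast
    obtain k \<alpha> v where k: "k < num_types \<sigma>" "a \<le> \<alpha>" "\<alpha> \<le> b" "S = similar_copy \<alpha> v (prototile \<sigma> k)"
      using rule_copy j S by blast
    have \<alpha>: "0 < \<alpha>" using k a_pos by linarith
    obtain p' where p': "p' \<in> prototile \<sigma> k" "p = v + \<alpha> *\<^sub>R p'" using S k by (auto simp: similar_copy_def)
    have ne: "interior (prototile \<sigma> k) \<noteq> {}" using zero_in_interior_prototile[OF k(1)] by auto
    have "interior S = similar_copy \<alpha> v (interior (prototile \<sigma> k))"
      using interior_similar_copy[OF \<alpha>] k by simp
    then have sub: "similar_copy \<alpha> v (interior (prototile \<sigma> k)) \<subseteq> interior (prototile \<sigma> j)"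
      using interior_mono[OF S(3)] by simp
    have "x \<le> infdist p (similar_copy \<alpha> v (interior (prototile \<sigma> k)))"
      unfolding j by (rule infdist_mono[OF sub]) (use ne in \<open>auto simp: similar_copy_def\<close>)
    also have "\<dots> \<le> \<alpha> * infdist p' (interior (prototile \<sigma> k))"
      unfolding p' by (rule infdist_similar_copy_le[OF \<alpha> ne])
    also have "\<dots> \<le> b * infdist p' (interior (prototile \<sigma> k))"
      using k by (intro mult_right_mono) (auto simp: infdist_nonneg)
    also have "\<dots> \<le> b * Sup E"
    proof (intro mult_left_mono cSup_upper bdd)
      show "infdist p' (interior (prototile \<sigma> k)) \<in> E" using k p' by (auto simp: E_def)
    qed (use b_pos in simp)
    finally show ?thesis .
  qed
  show ?thesis
  proof
    fix p assume p: "p \<in> prototile \<sigma> i"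
    have pE: "infdist p (interior (prototile \<sigma> i)) \<in> E" using p i by (auto simp: E_def)
    then have "Sup E \<le> b * Sup E" using contract by (intro cSup_least) auto
    then have "(1 - b) * Sup E \<le> 0" by (simp add: algebra_simps)
    then have "Sup E \<le> 0" using b_less by (simp add: mult_le_0_iff)
    then have "infdist p (interior (prototile \<sigma> i)) \<le> 0"
      using cSup_upper[OF pE bdd] by linarith
    then have "infdist p (interior (prototile \<sigma> i)) = 0"
      using infdist_nonneg[of p "interior (prototile \<sigma> i)"] by linarith
    moreover have "interior (prototile \<sigma> i) \<noteq> {}" using zero_in_interior_prototile[OF i] by auto
    ultimately show "p \<in> closure (interior (prototile \<sigma> i))"
      by (simp add: in_closure_iff_infdist_zero)
  qed
qed

lemma copy_regular:
  assumes "is_copy \<sigma> \<mu> S" shows "S \<subseteq> closure (interior S)"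
proof -
  obtain j v where j: "j < num_types \<sigma>" "0 < \<mu>" "S = similar_copy \<mu> v (prototile \<sigma> j)"
    using assms by (auto simp: is_copy_def)
  show ?thesis
    unfolding j(3) interior_similar_copy[OF j(2)] closure_similar_copy
    by (rule similar_copy_mono[OF prototile_regular[OF j(1)]])
qed

text \<open>Disjointness of interiors is all that a tessellation provides; regularity of the copy upgrades it.\<close>

lemma interior_disjoint_copy:
  assumes "is_copy \<sigma> \<mu> S" "interior q \<inter> interior S = {}"
  shows "interior q \<inter> S = {}"
proof -
  have "interior q \<inter> closure (interior S) = {}"
    using assms(2) by (simp add: open_Int_closure_eq_empty)
  then show ?thesis using copy_regular[OF assms(1)] by blast
qed

section \<open>The structure of substituted tiles\<close>

text \<open>At the first stage at which the ancestors of \<open>q\<close> leave the line from \<open>S\<close> to \<open>S1\<close>, they lie in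
siblings, whose interiors are disjoint.\<close>

lemma leaf_or_disjoint:
  assumes "(divides \<sigma>)\<^sup>*\<^sup>* S S1" "is_copy \<sigma> \<mu> S" "q \<in> leaves \<sigma> S"
  shows "q \<in> leaves \<sigma> S1 \<or> interior q \<inter> interior S1 = {}"
  using assms
proof (induction arbitrary: \<mu> rule: converse_rtranclp_induct)
  case base
  then show ?case by simp
next
  case (step S S')
  have big: "measure lebesgue S > 1" and S': "S' \<in> substitute \<sigma> S"
    using step.hyps(1) by (auto simp: divides_def)
  obtain \<nu> where \<nu>: "is_copy \<sigma> \<nu> S'" using substitute_child(1)[OF step.prems(1) S'] by blast
  obtain S'' where S'': "S'' \<in> substitute \<sigma> S" "q \<in> leaves \<sigma> S''"
    using step.prems(2) leaves_large[OF big] by auto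
  show ?case
  proof (cases "S'' = S'")
    case True
    then show ?thesis using step.IH[OF \<nu>] S'' by simp
  next
    case False
    obtain \<nu>' where \<nu>': "is_copy \<sigma> \<nu>' S''" using substitute_child(1)[OF step.prems(1) S''(1)] by blast
    have "q \<subseteq> S''" using descendant_copy(2)[OF _ \<nu>'] S''(2) by (auto simp: leaves_def)
    moreover have "S1 \<subseteq> S'" using descendant_copy(2)[OF step.hyps(2) \<nu>] .
    ultimately show ?thesis
      using substitute_disjoint[OF step.prems(1) S''(1) S' False] interior_mono by blast
  qed
qed

text \<open>Finitely many tiles are divided, all of scale strictly above 1, and this persists under a small
contraction; tiles that are not divided only become smaller. From the right this fails, as a leaf of
scale exactly 1 would be divided.\<close>

lemma leaves_scale_left_continuous:
  assumes "is_copy \<sigma> \<mu> S"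
  shows "\<forall>\<^sub>F \<theta> in at_left 1. leaves \<sigma> (similar_copy \<theta> 0 S) = similar_copy \<theta> 0 ` leaves \<sigma> S"
  using assms
proof (induction rule: copy_induct)
  case (small \<mu> S)
  have 1: "leaves \<sigma> S = {S}" using leaves_small measure_copy_le_1 small by blast
  have "\<forall>\<^sub>F \<theta> in at_left (1::real). \<theta> \<in> {0<..<1}" by (rule eventually_at_left_real) simp
  then show ?case
  proof eventually_elim
    case (elim \<theta>)
    have "is_copy \<sigma> (\<theta> * \<mu>) (similar_copy \<theta> 0 S)"
      using small elim by (intro is_copy_similar_copy) auto
    moreover have "\<theta> * \<mu> \<le> 1" using elim small by (simp add: is_copy_def mult_le_one)
    ultimately have "leaves \<sigma> (similar_copy \<theta> 0 S) = {similar_copy \<theta> 0 S}"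
      using leaves_small measure_copy_le_1 by blast
    then show ?case using 1 by simp
  qed
next
  case (large \<mu> S)
  have "\<forall>\<^sub>F \<theta> in at_left (1::real). \<theta> \<in> {1/\<mu><..<1}"
    using large by (intro eventually_at_left_real) simp
  moreover have "\<forall>\<^sub>F \<theta> in at_left 1. \<forall>S'\<in>substitute \<sigma> S.
      leaves \<sigma> (similar_copy \<theta> 0 S') = similar_copy \<theta> 0 ` leaves \<sigma> S'"
    using large finite_substitute by (intro eventually_ball_finite) auto
  ultimately show ?case
  proof eventually_elim
    case (elim \<theta>)
    have \<theta>: "0 < \<theta>" using elim(1) large by (meson greaterThanLessThan_iff less_trans zero_less_divide_1_iff zero_less_one)
    have "is_copy \<sigma> (\<theta> * \<mu>) (similar_copy \<theta> 0 S)"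
      using large \<theta> by (intro is_copy_similar_copy) auto
    moreover have "\<theta> * \<mu> > 1" using elim(1) large by (simp add: field_simps)
    ultimately have "leaves \<sigma> (similar_copy \<theta> 0 S)
        = (\<Union>S'\<in>substitute \<sigma> (similar_copy \<theta> 0 S). leaves \<sigma> S')"
      using leaves_large measure_copy_gt_1 by blast
    also have "\<dots> = (\<Union>S'\<in>substitute \<sigma> S. similar_copy \<theta> 0 ` leaves \<sigma> S')"
      using elim(2) by (simp add: substitute_similar_copy[OF \<theta>])
    also have "\<dots> = similar_copy \<theta> 0 ` leaves \<sigma> S"
      using leaves_large measure_copy_gt_1 large by (metis image_UN)
    finally show ?case .
  qed
qed

text \<open>Scales along the line of descent from \<open>S\<close> to \<open>q\<close> drop by factors of at least \<open>a\<close>, so they cannot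
jump over the interval \<open>[a r, r]\<close>.\<close>

lemma supertile_between:
  assumes "(divides \<sigma>)\<^sup>*\<^sup>* S q" "is_copy \<sigma> \<mu> S" "a * r \<le> \<mu>" "is_copy \<sigma> \<nu> q" "\<nu> \<le> r"
  shows "\<exists>B \<kappa>. (divides \<sigma>)\<^sup>*\<^sup>* S B \<and> (divides \<sigma>)\<^sup>*\<^sup>* B q \<and> is_copy \<sigma> \<kappa> B \<and> a * r \<le> \<kappa> \<and> \<kappa> \<le> r"
  using assms
proof (induction arbitrary: \<mu> rule: converse_rtranclp_induct)
  case base
  then show ?case using is_copy_scale_unique by blast
next
  case (step S S')
  show ?case
  proof (cases "\<mu> \<le> r")
    case True
    then show ?thesis using step by (meson converse_rtranclp_into_rtranclp rtranclp.rtrancl_refl)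
  next
    case False
    obtain \<kappa> where \<kappa>: "a * \<mu> \<le> \<kappa>" "is_copy \<sigma> \<kappa> S'"
      using substitute_child(1)[OF step.prems(1)] step.hyps(1) unfolding divides_def by blast
    have "a * r \<le> a * \<mu>" using False a_pos by simp
    then have "a * r \<le> \<kappa>" using \<kappa> by linarith
    then obtain B \<kappa>' where "(divides \<sigma>)\<^sup>*\<^sup>* S' B" "(divides \<sigma>)\<^sup>*\<^sup>* B q" "is_copy \<sigma> \<kappa>' B" "a * r \<le> \<kappa>'" "\<kappa>' \<le> r"
      using step.IH \<kappa> step.prems by blast
    then show ?thesis using step.hyps(1) by (meson converse_rtranclp_into_rtranclp)
  qed
qed

end

section \<open>Walks in the substitution graph\<close>

text \<open>Walks in the directed graph on the types with one edge for each tile of a substitution rule.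
A walk of length \<open>l\<close> leads from a tile of scale \<open>e\<^sup>s\<close> to a descendant of scale \<open>e\<^bsup>s - l\<^esup>\<close>.\<close>

inductive walk :: "'a::euclidean_space scheme \<Rightarrow> nat \<Rightarrow> nat \<Rightarrow> real \<Rightarrow> bool" for \<sigma> where
  walk_refl: "walk \<sigma> i i 0"
| walk_step: "i < num_types \<sigma> \<Longrightarrow> j < num_types \<sigma> \<Longrightarrow> 0 < \<alpha> \<Longrightarrow> \<alpha> < 1 \<Longrightarrow>
    similar_copy \<alpha> v (prototile \<sigma> j) \<in> rule \<sigma> i \<Longrightarrow> walk \<sigma> j k l \<Longrightarrow> walk \<sigma> i k (l - ln \<alpha>)"

lemma walk_trans: "walk \<sigma> i j l \<Longrightarrow> walk \<sigma> j k l' \<Longrightarrow> walk \<sigma> i k (l + l')"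
proof (induction rule: walk.induct)
  case (walk_step i j \<alpha> v k' l)
  then have "walk \<sigma> i k (l + l' - ln \<alpha>)" by (blast intro: walk.walk_step)
  then show ?case by (simp add: algebra_simps)
qed simp

lemma walk_nonneg: "walk \<sigma> i j l \<Longrightarrow> l \<ge> 0"
proof (induction rule: walk.induct)
  case (walk_step i j \<alpha> v k l)
  then have "ln \<alpha> < 0" by simp
  then show ?case using walk_step by linarith
qed simp

lemma walk_repeat: "walk \<sigma> i i l \<Longrightarrow> walk \<sigma> i i (real p * l)"
proof (induction p)
  case (Suc p)
  then have "walk \<sigma> i i (l + real p * l)" by (blast intro: walk_trans)
  then show ?case by (simp add: algebra_simps)
qed (simp add: walk_refl)

context bounded_scheme begin

text \<open>All tiles on the way but the last one have scale above \<open>e\<^bsup>s - l\<^esup> \<ge> 1\<close>, so the process does divide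
them.\<close>

lemma walk_descendant:
  assumes "walk \<sigma> i k l" "i < num_types \<sigma>" "l \<le> s"
  shows "\<exists>w. (divides \<sigma>)\<^sup>*\<^sup>* (similar_copy (exp s) v (prototile \<sigma> i))
    (similar_copy (exp (s - l)) w (prototile \<sigma> k))"
  using assms
proof (induction arbitrary: s v rule: walk.induct)
  case (walk_refl i)
  then show ?case by auto
next
  case (walk_step i j \<alpha> v' k l)
  let ?S = "similar_copy (exp s) v (prototile \<sigma> i)"
  have ln: "ln \<alpha> < 0" using walk_step by simp
  have s: "0 < s" using ln walk_step walk_nonneg[OF walk_step(6)] by linarith
  have "is_copy \<sigma> (exp s) ?S" using walk_step by (simp add: is_copyI)
  then have "measure lebesgue ?S > 1" using measure_copy_gt_1 s by simp
  moreover have "similar_copy (exp s) v (similar_copy \<alpha> v' (prototile \<sigma> j)) \<in> substitute \<sigma> ?S"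
    using substitute_copy walk_step by simp
  ultimately have div: "divides \<sigma> ?S (similar_copy (exp s) v (similar_copy \<alpha> v' (prototile \<sigma> j)))"
    by (simp add: divides_def)
  have eq: "similar_copy (exp s) v (similar_copy \<alpha> v' (prototile \<sigma> j))
     = similar_copy (exp (s + ln \<alpha>)) (v + exp s *\<^sub>R v') (prototile \<sigma> j)"
    using walk_step by (simp add: similar_copy_compose exp_add)
  have "l \<le> s + ln \<alpha>" using walk_step by linarith
  then obtain w where "(divides \<sigma>)\<^sup>*\<^sup>* (similar_copy (exp (s + ln \<alpha>)) (v + exp s *\<^sub>R v') (prototile \<sigma> j))
    (similar_copy (exp (s + ln \<alpha> - l)) w (prototile \<sigma> k))"
    using walk_step.IH walk_step by blast
  then show ?case
    using div eq converse_rtranclp_into_rtranclp[of "divides \<sigma>"] by (metis diff_diff_eq2)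
qed

lemma descendant_walk:
  assumes "(divides \<sigma>)\<^sup>*\<^sup>* (similar_copy (exp s) v (prototile \<sigma> i)) X" "i < num_types \<sigma>"
  shows "\<exists>k<num_types \<sigma>. \<exists>l w. walk \<sigma> i k l \<and> X = similar_copy (exp (s - l)) w (prototile \<sigma> k)"
  using assms
proof (induction rule: rtranclp_induct)
  case base
  then show ?case using walk_refl by (metis diff_0_right)
next
  case (step X Y)
  then obtain k l w where k: "k < num_types \<sigma>" "walk \<sigma> i k l"
    "X = similar_copy (exp (s - l)) w (prototile \<sigma> k)" by blast
  then have "Y \<in> similar_copy (exp (s - l)) w ` rule \<sigma> k"
    using step.hyps(2) substitute_copy unfolding divides_def by simp
  then obtain Z where Z: "Z \<in> rule \<sigma> k" "Y = similar_copy (exp (s - l)) w Z" by auto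
  then obtain j \<alpha> v' where j: "j < num_types \<sigma>" "a \<le> \<alpha>" "\<alpha> \<le> b" "Z = similar_copy \<alpha> v' (prototile \<sigma> j)"
    using rule_copy k by blast
  have \<alpha>: "0 < \<alpha>" "\<alpha> < 1" using j a_pos b_less by linarith+
  have "walk \<sigma> k j (0 - ln \<alpha>)" using walk_step[OF k(1) j(1) \<alpha> _ walk_refl] Z j by simp
  then have "walk \<sigma> i j (l + (0 - ln \<alpha>))" using k walk_trans by blast
  moreover have "Y = similar_copy (exp (s - (l + (0 - ln \<alpha>)))) (w + exp (s - l) *\<^sub>R v') (prototile \<sigma> j)"
    using \<alpha> by (simp add: Z j similar_copy_compose exp_add exp_diff)
  ultimately show ?case using j by blast
qed

text \<open>In a patch at time \<open>t\<close> the walk length \<open>l\<close> gives scale \<open>e\<^bsup>t - l\<^esup>\<close>; unit volume forces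
\<open>l = t\<close>. This turns irreducibility and incommensurability into statements about walks.\<close>

lemma flow_walk:
  assumes "S \<in> flow \<sigma> t i" "of_type \<sigma> j S" "i < num_types \<sigma>" "j < num_types \<sigma>"
  shows "\<exists>l. walk \<sigma> i j l \<and> (measure lebesgue S = 1 \<longrightarrow> l = t)"
proof -
  obtain k l w where k: "k < num_types \<sigma>" "walk \<sigma> i k l" "S = similar_copy (exp (t - l)) w (prototile \<sigma> k)"
    using descendant_walk assms unfolding flow_eq_leaves leaves_def by blast
  obtain \<alpha> v where "0 < \<alpha>" "S = similar_copy \<alpha> v (prototile \<sigma> j)"
    using assms by (auto simp: of_type_def)
  then have "k = j" using copy_unique[of k j "exp (t - l)" \<alpha>] k assms by auto
  have "measure lebesgue S = exp (t - l) ^ DIM('a)"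
    using k by (simp add: measure_similar_copy measure_prototile)
  then have "l = t" if "measure lebesgue S = 1"
    using that power_eq_imp_eq_base[of "exp (t - l)" "DIM('a)" 1] by simp
  then show ?thesis using k \<open>k = j\<close> by blast
qed

text \<open>The incommensurable closed walks may sit at different types \<open>g\<close> and \<open>h\<close>. A round trip from \<open>h\<close>
through \<open>g\<close>, of length \<open>c\<close>, can be taken with or without the loop at \<open>g\<close>, so the closed walks at \<open>h\<close>
include lengths \<open>t2\<close>, \<open>c\<close> and \<open>c + t1\<close>, which generate an eventually dense semigroup.\<close>

lemma walks_eventually_dense:
  assumes irr: "irreducible_scheme \<sigma>" and inc: "incommensurable \<sigma>"
    and i: "i < num_types \<sigma>" and k: "k < num_types \<sigma>" and \<eta>: "\<eta> > 0"
  shows "\<exists>L. \<forall>x\<ge>L. \<exists>l. x \<le> l \<and> l < x + \<eta> \<and> walk \<sigma> i k l"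
proof -
  have connected: "\<exists>l. walk \<sigma> i j l" if "i < num_types \<sigma>" "j < num_types \<sigma>" for i j
    using irr flow_walk that unfolding irreducible_scheme_def by blast
  obtain g h t1 t2 where g: "g < num_types \<sigma>" and h: "h < num_types \<sigma>" and t: "t1 > 0" "t2 > 0"
    and q: "\<not> (\<exists>q\<in>\<rat>. t1 = q * t2)"
    and S: "\<exists>S\<in>flow \<sigma> t1 g. of_type \<sigma> g S \<and> measure lebesgue S = 1"
      "\<exists>S\<in>flow \<sigma> t2 h. of_type \<sigma> h S \<and> measure lebesgue S = 1"
    using inc unfolding incommensurable_def by blast
  have w1: "walk \<sigma> g g t1" and w2: "walk \<sigma> h h t2"
    using S flow_walk[OF _ _ g g] flow_walk[OF _ _ h h] by blast+
  obtain l1 where l1: "walk \<sigma> i h l1" using connected i h by blast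
  obtain l2 where l2: "walk \<sigma> h k l2" using connected h k by blast
  obtain c1 where c1: "walk \<sigma> h g c1" using connected h g by blast
  obtain c2 where c2: "walk \<sigma> g h c2" using connected h g by blast
  define c where "c = c1 + c2"
  have wc: "walk \<sigma> h h c" unfolding c_def by (rule walk_trans[OF c1 c2])
  have wc1: "walk \<sigma> h h (c + t1)"
    using walk_trans[OF c1 walk_trans[OF w1 c2]] by (simp add: c_def algebra_simps)
  have "t1 / t2 \<notin> \<rat>" using q t by (metis less_irrefl nonzero_eq_divide_eq)
  then obtain L where L: "\<And>x. x \<ge> L \<Longrightarrow> \<exists>(p::nat) (q::nat) (r::nat). x \<le> p * t2 + q * c + r * (c + t1) \<and>
            p * t2 + q * c + r * (c + t1) < x + \<eta>"
    using semigroup_eventually_dense[OF t(2) t(1) _ \<eta>] by metis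
  show ?thesis
  proof (rule exI[of _ "L + l1 + l2"], intro allI impI)
    fix x assume "x \<ge> L + l1 + l2"
    then have "x - l1 - l2 \<ge> L" by simp
    then obtain p q r :: nat where pqr: "x - l1 - l2 \<le> p * t2 + q * c + r * (c + t1)"
            "p * t2 + q * c + r * (c + t1) < x - l1 - l2 + \<eta>" using L by blast
    have "walk \<sigma> h h (p * t2 + (q * c + r * (c + t1)))"
      using walk_repeat[OF w2] walk_repeat[OF wc] walk_repeat[OF wc1] by (blast intro: walk_trans)
    then have "walk \<sigma> i k (l1 + ((p * t2 + (q * c + r * (c + t1))) + l2))"
      using l1 l2 by (blast intro: walk_trans)
    then show "\<exists>l. x \<le> l \<and> l < x + \<eta> \<and> walk \<sigma> i k l"
      using pqr
      by (intro exI[of _ "l1 + ((p * t2 + (q * c + r * (c + t1))) + l2)"] conjI) linarith+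
  qed
qed

end

section \<open>Agreement of closed sets near the origin\<close>

text \<open>The relation underlying \<^const>\<open>D\<close>: for \<open>r \<le> 1\<close>, a distance below \<open>r\<close> entails agreement up to \<open>r\<close> on
the ball of radius \<open>1 / r\<close>, which entails a distance of at most \<open>r\<close>. Separate parameters for precision and radius make it possible to compose and
to recentre such comparisons at an explicit cost in the radius.\<close>

definition agree :: "real \<Rightarrow> real \<Rightarrow> 'a::euclidean_space set \<Rightarrow> 'a set \<Rightarrow> bool" where
  "agree r R A B \<longleftrightarrow> A \<inter> ball 0 R \<subseteq> nbhd r B \<and> B \<inter> ball 0 R \<subseteq> nbhd r A"

definition view :: "'a::euclidean_space \<Rightarrow> 'a set \<Rightarrow> 'a set" where
  "view x A = (\<lambda>p. p - x) ` A"

lemma nbhdI: "q \<in> A \<Longrightarrow> dist p q < r \<Longrightarrow> p \<in> nbhd r A"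
  by (auto simp: nbhd_def)

lemma agreeE:
  assumes "agree r R A B" "p \<in> A" "p \<in> ball 0 R"
  obtains q where "q \<in> B" "dist p q < r"
  using assms unfolding agree_def nbhd_def by blast

lemma mem_view_iff: "p \<in> view x A \<longleftrightarrow> p + x \<in> A"
proof
  assume "p + x \<in> A"
  then have "(p + x) - x \<in> view x A" unfolding view_def by (rule imageI)
  then show "p \<in> view x A" by simp
qed (auto simp: view_def)

lemma agree_sym: "agree r R A B \<Longrightarrow> agree r R B A"
  by (auto simp: agree_def)

lemma agree_mono: "agree r R A B \<Longrightarrow> r \<le> r' \<Longrightarrow> R' \<le> R \<Longrightarrow> agree r' R' A B"
proof -
  assume *: "agree r R A B" "r \<le> r'" "R' \<le> R"
  have "nbhd r X \<subseteq> nbhd r' X" for X :: "'a set"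
    using *(2) unfolding nbhd_def by (auto intro: less_le_trans)
  moreover have "ball (0::'a) R' \<subseteq> ball 0 R" using *(3) by (rule subset_ball)
  ultimately show "agree r' R' A B" using *(1) unfolding agree_def by blast
qed

lemma agree_trans:
  assumes "agree r R1 A B" "agree s R2 B C" "R + r \<le> R2" "R + s \<le> R1"  "r \<ge> 0" "s \<ge> 0"
  shows "agree (r + s) R A C"
proof -
  have *: "A \<inter> ball 0 R \<subseteq> nbhd (r + s) C"
    if h: "agree r R1 A B" "agree s R2 B C" "R + r \<le> R2" "R \<le> R1" for A B C :: "'a set" and r s R1 R2
  proof
    fix p assume p: "p \<in> A \<inter> ball 0 R"
    then have "p \<in> A" "p \<in> ball 0 R1" using h(4) by auto
    then obtain q where q: "q \<in> B" "dist p q < r" by (rule agreeE[OF h(1)])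
    have "dist 0 q \<le> dist 0 p + dist p q" by (rule dist_triangle)
    then have "q \<in> ball 0 R2" using p q h by auto
    with q(1) obtain u where u: "u \<in> C" "dist q u < s" by (rule agreeE[OF h(2)])
    have "dist p u \<le> dist p q + dist q u" by (rule dist_triangle)
    then show "p \<in> nbhd (r + s) C" using u q by (intro nbhdI[of u]) linarith+
  qed
  have "C \<inter> ball 0 R \<subseteq> nbhd (s + r) A"
    by (rule *[OF agree_sym[OF assms(2)] agree_sym[OF assms(1)]]) (use assms in auto)
  moreover have "A \<inter> ball 0 R \<subseteq> nbhd (r + s) C"
    by (rule *[OF assms(1,2)]) (use assms in auto)
  ultimately show ?thesis by (simp add: agree_def add.commute)
qed

lemma agree_view_shift:
  assumes "agree r R (view x A) (view y B)" "norm d + R' \<le> R"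
  shows "agree r R' (view (x + d) A) (view (y + d) B)"
proof -
  have *: "view (x + d) A \<inter> ball 0 R' \<subseteq> nbhd r (view (y + d) B)"
    if h: "agree r R (view x A) (view y B)" for x y A B
  proof
    fix p assume p: "p \<in> view (x + d) A \<inter> ball 0 R'"
    have "norm (p + d) < R" using p assms(2) norm_triangle_ineq[of p d] by auto
    moreover have "p + d \<in> view x A" using p by (simp add: mem_view_iff algebra_simps)
    ultimately obtain q where q: "q \<in> view y B" "dist (p + d) q < r"
      using agreeE[OF h, of "p + d"] by auto
    have "dist p (q - d) = dist (p + d) q" by (simp add: dist_norm algebra_simps)
    moreover have "q - d \<in> view (y + d) B" using q by (simp add: mem_view_iff)
    ultimately show "p \<in> nbhd r (view (y + d) B)" using q by (intro nbhdI[of "q - d"]) simp_all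
  qed
  show ?thesis using *[OF assms(1)] *[OF agree_sym[OF assms(1)]] by (simp add: agree_def)
qed

text \<open>Seen from \<open>y\<close> and from its image, the similarity is the contraction by \<open>\<theta>\<close> about the origin, which
moves points of norm below \<open>R\<close> by at most \<open>(1 - \<theta>) R\<close>.\<close>

lemma agree_scaled:
  fixes A :: "'a::euclidean_space set"
  assumes \<theta>: "0 < \<theta>" "\<theta> \<le> 1" and small: "(1 - \<theta>) * R < \<delta>" and R': "R' \<le> \<theta> * R"
  shows "agree \<delta> R' (view y A) (view (w + \<theta> *\<^sub>R y) (similar_copy \<theta> w A))"
proof -
  have dist: "dist p (\<theta> *\<^sub>R p) < \<delta>" if "norm p < R" for p :: 'a
  proof -
    have "dist p (\<theta> *\<^sub>R p) = norm ((1 - \<theta>) *\<^sub>R p)" by (simp add: dist_norm scaleR_diff_left)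
    also have "\<dots> = (1 - \<theta>) * norm p" using \<theta> by simp
    also have "\<dots> \<le> (1 - \<theta>) * R" using \<theta> that by (intro mult_left_mono) auto
    finally show ?thesis using small by linarith
  qed
  have "view y A \<inter> ball 0 R' \<subseteq> nbhd \<delta> (view (w + \<theta> *\<^sub>R y) (similar_copy \<theta> w A))"
  proof
    fix p assume p: "p \<in> view y A \<inter> ball 0 R'"
    then have "0 < R'" by (auto intro: le_less_trans[OF norm_ge_zero])
    then have "0 < \<theta> * R" using R' by linarith
    then have "R > 0" using \<theta> by (simp add: zero_less_mult_iff)
    then have "\<theta> * R \<le> R" using \<theta> by (simp add: mult_le_cancel_right1)
    then have "dist p (\<theta> *\<^sub>R p) < \<delta>" using dist p R' by auto
    moreover have eq: "\<theta> *\<^sub>R p + (w + \<theta> *\<^sub>R y) = w + \<theta> *\<^sub>R (p + y)" by (simp add: algebra_simps)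
    have "p + y \<in> A" using p by (simp add: mem_view_iff)
    then have "\<theta> *\<^sub>R p \<in> view (w + \<theta> *\<^sub>R y) (similar_copy \<theta> w A)"
      unfolding mem_view_iff similar_copy_def eq by (rule imageI)
    ultimately show "p \<in> nbhd \<delta> (view (w + \<theta> *\<^sub>R y) (similar_copy \<theta> w A))" by (rule nbhdI[rotated])
  qed
  moreover have "view (w + \<theta> *\<^sub>R y) (similar_copy \<theta> w A) \<inter> ball 0 R' \<subseteq> nbhd \<delta> (view y A)"
  proof
    fix p assume p: "p \<in> view (w + \<theta> *\<^sub>R y) (similar_copy \<theta> w A) \<inter> ball 0 R'"
    then obtain u where u: "u \<in> A" "p + (w + \<theta> *\<^sub>R y) = w + \<theta> *\<^sub>R u"
      by (auto simp: mem_view_iff similar_copy_def)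
    then have pu: "p = \<theta> *\<^sub>R (u - y)" by (simp add: algebra_simps)
    have "\<theta> * norm (u - y) = norm p" using \<theta> by (simp add: pu)
    also have "\<dots> < R'" using p by simp
    finally have "\<theta> * norm (u - y) < \<theta> * R" using R' by linarith
    then have "norm (u - y) < R" using \<theta>(1) by (rule mult_left_less_imp_less[OF _ less_imp_le])
    then have "dist p (u - y) < \<delta>" using dist[of "u - y"] pu by (simp add: dist_commute)
    then show "p \<in> nbhd \<delta> (view y A)" using u by (intro nbhdI[of "u - y"]) (simp_all add: mem_view_iff)
  qed
  ultimately show ?thesis unfolding agree_def by blast
qed

lemma D_lessI:
  assumes "agree r (1 / r) A B" "0 < r" "r < \<epsilon>"
  shows "D A B < \<epsilon>"
proof -
  let ?X = "{r. r > 0 \<and> A \<inter> ball 0 (1 / r) \<subseteq> nbhd r B \<and> B \<inter> ball 0 (1 / r) \<subseteq> nbhd r A} \<union> {1}"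
  have "bdd_below ?X" by (rule bdd_belowI[of _ 0]) auto
  moreover have "r \<in> ?X" using assms by (simp add: agree_def)
  ultimately have "Inf ?X \<le> r" by (rule cInf_lower[rotated])
  then show ?thesis using assms by (simp add: D_def)
qed

lemma D_less_imp_agree:
  assumes "D A B < r" "r \<le> 1"
  shows "agree r (1 / r) A B"
proof -
  let ?X = "{r. r > 0 \<and> A \<inter> ball 0 (1 / r) \<subseteq> nbhd r B \<and> B \<inter> ball 0 (1 / r) \<subseteq> nbhd r A} \<union> {1}"
  have "Inf ?X < r" using assms by (simp add: D_def)
  then obtain s where s: "s \<in> ?X" "s < r" using cInf_lessD[of ?X r] by blast
  then have "agree s (1 / s) A B" "0 < s" using assms by (auto simp: agree_def)
  then show ?thesis using s by (auto elim!: agree_mono intro!: divide_left_mono)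
qed

lemma boundary_translate: "boundary (translate v P) = (+) v ` boundary P"
  by (auto simp: boundary_def translate_def frontier_translation)

lemma boundary_mono: "P \<subseteq> Q \<Longrightarrow> boundary P \<subseteq> boundary Q"
  by (auto simp: boundary_def)

lemma boundary_similar_copy:
  fixes P :: "'a::euclidean_space set set"
  assumes "0 < \<theta>" shows "boundary (similar_copy \<theta> w ` P) = similar_copy \<theta> w (boundary P)"
  using assms by (simp add: boundary_def frontier_similar_copy) (simp add: similar_copy_def image_UN)

lemma tiling_dist_translate:
  "tiling_dist (translate (- y) T) (translate (- x) T') = D (view y (boundary T)) (view x (boundary T'))"
  by (simp add: tiling_dist_def boundary_translate view_def)

text \<open>Sets that meet the same balls of radius \<open>r / 2\<close> around a finite \<open>r / 2\<close>-net of the ball of radius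
\<open>R\<close> agree there up to \<open>r\<close>, and a finite net has finitely many subsets.\<close>

lemma finitely_many_views:
  fixes f :: "'i \<Rightarrow> 'a::euclidean_space set"
  assumes "r > 0"
  shows "\<exists>F\<subseteq>I. finite F \<and> (\<forall>i\<in>I. \<exists>j\<in>F. agree r R (f i) (f j))"
proof -
  have "cball 0 R \<subseteq> (\<Union>n\<in>cball (0::'a) R. ball n (r/2))" using assms by force
  then obtain N where N: "N \<subseteq> cball (0::'a) R" "finite N" "cball 0 R \<subseteq> (\<Union>n\<in>N. ball n (r/2))"
    using compactE_image[OF compact_cball[of "0::'a" R], of "cball 0 R" "\<lambda>n. ball n (r/2)"] by (metis open_ball)
  define code where "code i = {n \<in> N. f i \<inter> ball n (r/2) \<noteq> {}}" for i
  have "finite (code ` I)"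
    using N(2) by (intro finite_subset[of "code ` I" "Pow N"]) (auto simp: code_def)
  then obtain F where F: "F \<subseteq> I" "finite F" "code ` I = code ` F"
    using finite_subset_image[of "code ` I" code I] by auto
  have *: "f i \<inter> ball 0 R \<subseteq> nbhd r (f j)" if "code i = code j" for i j
  proof
    fix p assume p: "p \<in> f i \<inter> ball 0 R"
    then have "p \<in> cball 0 R" by auto
    then obtain n where n: "n \<in> N" "p \<in> ball n (r/2)" using N by blast
    then have "n \<in> code j" using p that unfolding code_def by blast
    then obtain q where q: "q \<in> f j" "q \<in> ball n (r/2)" unfolding code_def by blast
    have "dist p q \<le> dist n p + dist n q" by (rule dist_triangle3)
    then show "p \<in> nbhd r (f j)" using n q by (intro nbhdI[of q]) auto
  qed
  have "\<exists>j\<in>F. agree r R (f i) (f j)" if "i \<in> I" for i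
  proof -
    have "code i \<in> code ` F" unfolding F(3)[symmetric] using that by (rule imageI)
    then obtain j where j: "j \<in> F" "code i = code j" by (rule imageE)
    then have "agree r R (f i) (f j)" unfolding agree_def using *[OF j(2)] *[OF j(2)[symmetric]] by simp
    then show ?thesis using j(1) by blast
  qed
  then show ?thesis using F by blast
qed

lemma separated_imp_finite:
  fixes f :: "'i \<Rightarrow> 'a::metric_space"
  assumes "compact K" "f ` A \<subseteq> K" "e > 0"
    and sep: "\<And>x y. x \<in> A \<Longrightarrow> y \<in> A \<Longrightarrow> x \<noteq> y \<Longrightarrow> dist (f x) (f y) \<ge> e"
  shows "finite A"
proof -
  have "K \<subseteq> (\<Union>n\<in>K. ball n (e/2))" using assms by force
  then obtain N where N: "N \<subseteq> K" "finite N" "K \<subseteq> (\<Union>n\<in>N. ball n (e/2))"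
    using compactE_image[OF assms(1), of K "\<lambda>n. ball n (e/2)"] by (metis open_ball)
  have "\<exists>g. \<forall>x\<in>A. g x \<in> N \<and> f x \<in> ball (g x) (e/2)" using N assms(2) by (intro bchoice) blast
  then obtain g where g: "\<And>x. x \<in> A \<Longrightarrow> g x \<in> N \<and> f x \<in> ball (g x) (e/2)" by blast
  have "inj_on g A"
  proof (rule inj_onI, rule ccontr)
    fix x y assume xy: "x \<in> A" "y \<in> A" "g x = g y" "x \<noteq> y"
    have "dist (f x) (f y) \<le> dist (g x) (f x) + dist (g x) (f y)" by (rule dist_triangle3)
    also have "\<dots> < e" using g[OF xy(1)] g[OF xy(2)] xy(3) by auto
    finally show False using sep[OF xy(1,2,4)] by simp
  qed
  moreover have "finite (g ` A)" using N(2) g by (meson finite_subset image_subsetI)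
  ultimately show ?thesis by (simp add: finite_image_iff)
qed

lemma ex_point_off_negligible:
  fixes U :: "'a::euclidean_space set"
  assumes "open U" "U \<noteq> {}" "negligible N" shows "\<exists>z\<in>U. z \<notin> N"
  using assms open_not_negligible negligible_subset by blast

section \<open>Local patterns of tilings occur in generating patches\<close>

context bounded_scheme begin

text \<open>A tile near \<open>x\<close> contains a ball of radius \<open>a * \<rho>\<close> whose centre is still in \<open>ball x R\<close>. So a set
that comes within \<open>a * \<rho>\<close> of every point of \<open>ball x R\<close> meets the interior of that tile. Covering
up to this tolerance, rather than exactly, is what survives limits of patches and small
changes of scale.\<close>

lemma copy_near_meets:
  assumes "is_copy \<sigma> \<nu> q" "a \<le> \<nu>" "\<nu> \<le> 1" "p \<in> frontier q" "p \<in> ball x (R - M)"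
    and cov: "ball x R \<subseteq> nbhd (a * \<rho>) X"
  shows "interior q \<inter> X \<noteq> {}"
proof -
  obtain w where w: "ball w (a * \<rho>) \<subseteq> interior q" "q \<subseteq> cball w M" using copy_ball assms by blast
  have "p \<in> closure q" using assms by (simp add: frontier_def)
  then have "p \<in> cball w M" using w(2) closure_minimal[OF _ closed_cball] by blast
  moreover have "dist x w \<le> dist x p + dist w p" by (metis dist_commute dist_triangle)
  ultimately have "w \<in> ball x R" using assms(5) by auto
  then obtain u where "u \<in> X" "dist w u < a * \<rho>" using cov by (auto simp: nbhd_def)
  then show ?thesis using w by auto
qed

lemma generating_patch_tile_copy:
  assumes "G \<in> generating_patches \<sigma>" "q \<in> G"
  shows "\<exists>\<nu>. a \<le> \<nu> \<and> \<nu> \<le> 1 \<and> is_copy \<sigma> \<nu> q"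
proof -
  obtain t i where ti: "0 \<le> t" "i < num_types \<sigma>" "G = flow \<sigma> t i"
    using assms by (auto simp: generating_patches_def)
  have "is_copy \<sigma> (exp t) (similar_copy (exp t) 0 (prototile \<sigma> i))" using ti by (simp add: is_copyI)
  then show ?thesis using leaf_copy assms(2) ti unfolding flow_eq_leaves by simp
qed

lemma generating_patch_disjoint:
  assumes "G \<in> generating_patches \<sigma>" "q \<in> G" "q' \<in> G" "q \<noteq> q'"
  shows "interior q \<inter> q' = {}"
proof -
  obtain t i where ti: "0 \<le> t" "i < num_types \<sigma>" "G = flow \<sigma> t i"
    using assms by (auto simp: generating_patches_def)
  have copy: "is_copy \<sigma> (exp t) (similar_copy (exp t) 0 (prototile \<sigma> i))" using ti by (simp add: is_copyI)
  obtain \<nu> where \<nu>: "is_copy \<sigma> \<nu> q'" using generating_patch_tile_copy assms by blast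
  have "(divides \<sigma>)\<^sup>*\<^sup>* (similar_copy (exp t) 0 (prototile \<sigma> i)) q'" "leaves \<sigma> q' = {q'}"
    using assms ti leaves_small unfolding flow_eq_leaves by (auto simp: leaves_def)
  then have "interior q \<inter> interior q' = {}"
    using leaf_or_disjoint[OF _ copy] assms ti unfolding flow_eq_leaves by blast
  then show ?thesis using interior_disjoint_copy \<nu> by blast
qed

lemma patch_limitE:
  assumes "\<T> \<in> tiling_space \<sigma>" "sub_patch P \<T>" "0 < r" "r \<le> 1"
  obtains G Q v where "G \<in> generating_patches \<sigma>" "Q \<subseteq> G"
    "agree r (1 / r) (boundary (translate v Q)) (boundary P)"
    "agree r (1 / r) (closure (\<Union>(translate v Q))) (closure (\<Union>P))"
proof -
  obtain Q v where Q: "\<And>k. \<exists>G\<in>generating_patches \<sigma>. sub_patch (Q k) G"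
    and lim: "patch_limit (\<lambda>k. translate (v k) (Q k)) P"
    using assms unfolding tiling_space_def by blast
  have "\<forall>\<^sub>F k in sequentially. D (boundary (translate (v k) (Q k))) (boundary P) < r"
    "\<forall>\<^sub>F k in sequentially. D (closure (\<Union>(translate (v k) (Q k)))) (closure (\<Union>P)) < r"
    using lim \<open>0 < r\<close> by (auto simp: patch_limit_def intro: order_tendstoD)
  then have "\<forall>\<^sub>F k in sequentially. D (boundary (translate (v k) (Q k))) (boundary P) < r \<and>
    D (closure (\<Union>(translate (v k) (Q k)))) (closure (\<Union>P)) < r" by (rule eventually_conj)
  then obtain k where "D (boundary (translate (v k) (Q k))) (boundary P) < r"
    "D (closure (\<Union>(translate (v k) (Q k)))) (closure (\<Union>P)) < r"
    using eventually_happens'[OF sequentially_bot] by blast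
  moreover obtain G where "G \<in> generating_patches \<sigma>" "Q k \<subseteq> G" using Q by (auto simp: sub_patch_def)
  ultimately show ?thesis using that D_less_imp_agree \<open>r \<le> 1\<close> by blast
qed

lemma sub_patchI:
  assumes "tiling \<T>" "P \<subseteq> \<T>" "bounded (\<Union>P)"
  shows "sub_patch P \<T>"
  using assms unfolding sub_patch_def patch_def tiling_def tessellation_def
  by (auto intro: pairwise_subset)

text \<open>The patch consisting of \<open>S\<close> alone is close, in support, to a patch of copies of prototiles. One of
these copies is near \<open>p\<close>, and the ball inside that copy is within \<open>r\<close> of \<open>S\<close>.\<close>

lemma tile_nearly_contains_ball:
  assumes T: "\<T> \<in> tiling_space \<sigma>" and S: "S \<in> \<T>" and p: "p \<in> S" and r: "0 < r" "r \<le> 1"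
    "norm p + 2 * M + 2 \<le> 1 / r"
  shows "\<exists>w. dist p w \<le> M + 2 \<and> ball w (a * \<rho>) \<subseteq> nbhd r (closure S)"
proof -
  have tT: "tiling \<T>" using T by (simp add: tiling_space_def)
  then have "bounded S" using S by (auto simp: tiling_def tessellation_def tile_def)
  then have "sub_patch {S} \<T>" using tT S by (intro sub_patchI) auto
  then obtain G Q v where G: "G \<in> generating_patches \<sigma>" "Q \<subseteq> G"
    "agree r (1 / r) (closure (\<Union>(translate v Q))) (closure (\<Union>{S}))"
    using patch_limitE[OF T _ r(1,2)] by metis
  have pS: "p \<in> closure S \<inter> ball 0 (1 / r)" using p r(3) M_pos closure_subset by auto
  then obtain p' where p': "p' \<in> closure (\<Union>(translate v Q))" "dist p p' < r"
    using agreeE[OF agree_sym[OF G(3)], of p] by auto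
  then obtain p'' where p'': "p'' \<in> \<Union>(translate v Q)" "dist p'' p' < 1"
    using closure_approachableD[of p' "\<Union>(translate v Q)" 1] by (metis dist_commute zero_less_one)
  obtain q where q: "q \<in> Q" "p'' \<in> (+) v ` q" using p'' by (auto simp: translate_def)
  obtain \<nu> where \<nu>: "a \<le> \<nu>" "\<nu> \<le> 1" "is_copy \<sigma> \<nu> q" using generating_patch_tile_copy G q by blast
  then have "is_copy \<sigma> (1 * \<nu>) (similar_copy 1 v q)" by (intro is_copy_similar_copy) auto
  then have "is_copy \<sigma> \<nu> ((+) v ` q)" by (simp add: similar_copy_def)
  then obtain w where w: "ball w (a * \<rho>) \<subseteq> interior ((+) v ` q)" "(+) v ` q \<subseteq> cball w M"
    using copy_ball \<nu> by blast
  have "dist w p'' \<le> M" using w q by auto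
  moreover have "dist p w \<le> dist p p' + dist p'' p' + dist w p''"
    by (metis add.commute dist_commute dist_triangle dist_triangle_le add_left_mono add.assoc)
  ultimately have pw: "dist p w < M + 2" using p' p'' r by linarith
  have "ball w (a * \<rho>) \<subseteq> nbhd r (closure S)"
  proof
    fix z assume z: "z \<in> ball w (a * \<rho>)"
    then have zq: "z \<in> (+) v ` q" using w interior_subset by blast
    then have "z \<in> closure (\<Union>(translate v Q))"
      using q closure_subset[of "\<Union>(translate v Q)"] by (auto simp: translate_def)
    moreover have "dist w z \<le> M" using zq w by auto
    then have "norm z < 1 / r"
      using r(3) pw norm_triangle_ineq2[of z p] dist_triangle[of z p w]
      by (simp add: dist_norm norm_minus_commute)
    ultimately show "z \<in> nbhd r (closure S)" using G(3) by (auto simp: agree_def)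
  qed
  then show ?thesis using pw by (intro exI[of _ w]) auto
qed

text \<open>The centres obtained for smaller and smaller precision stay in a compact ball, and a limit of them
is the centre of a ball in the closure.\<close>

lemma tile_contains_ball:
  assumes T: "\<T> \<in> tiling_space \<sigma>" and S: "S \<in> \<T>" and p: "p \<in> S"
  shows "\<exists>w. dist p w \<le> M + 2 \<and> ball w (a * \<rho>) \<subseteq> closure S"
proof -
  define r where "r m = 1 / (norm p + 2 * M + 2 + real m)" for m
  have pos: "norm p + 2 * M + 2 + real m > 1" for m
    using M_pos norm_ge_zero[of p] by linarith
  have "\<exists>w. dist p w \<le> M + 2 \<and> ball w (a * \<rho>) \<subseteq> nbhd (r m) (closure S)" for m
    using tile_nearly_contains_ball[OF assms, of "r m"] pos[of m] by (auto simp: r_def)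
  then obtain w where w: "\<And>m. dist p (w m) \<le> M + 2" "\<And>m. ball (w m) (a * \<rho>) \<subseteq> nbhd (r m) (closure S)"
    by metis
  have "\<And>m. w m \<in> cball p (M + 2)" using w by auto
  then obtain l f where l: "l \<in> cball p (M + 2)" "strict_mono f" "(w \<circ> f) \<longlonglongrightarrow> l"
    using compact_cball[of p "M + 2"] unfolding compact_def by metis
  have "ball l (a * \<rho>) \<subseteq> closure S"
  proof
    fix z assume z: "z \<in> ball l (a * \<rho>)"
    have "(\<lambda>m. dist ((w \<circ> f) m) z) \<longlonglongrightarrow> dist l z" by (intro tendsto_intros l)
    then have ev: "\<forall>\<^sub>F m in sequentially. dist (w (f m)) z < a * \<rho>"
      using z by (auto dest: order_tendstoD)
    have "r \<longlonglongrightarrow> 0"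
      unfolding r_def by (intro tendsto_divide_0[OF tendsto_const] filterlim_at_top_imp_at_infinity
          filterlim_tendsto_add_at_top[OF tendsto_const] filterlim_real_sequentially)
    then have "(r \<circ> f) \<longlonglongrightarrow> 0" using l(2) by (rule LIMSEQ_subseq_LIMSEQ)
    moreover have "\<forall>\<^sub>F m in sequentially. infdist z (closure S) \<le> (r \<circ> f) m"
      using ev
    proof eventually_elim
      case (elim m)
      then have "z \<in> nbhd (r (f m)) (closure S)" using w(2)[of "f m"] by auto
      then obtain s where "s \<in> closure S" "dist z s < r (f m)" by (auto simp: nbhd_def)
      then show ?case using infdist_le2[of s "closure S" z "r (f m)"] by simp
    qed
    ultimately have "infdist z (closure S) \<le> 0"
      by (intro tendsto_lowerbound[where f = "r \<circ> f"]) auto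
    then have "infdist z (closure S) = 0" using infdist_nonneg[of z "closure S"] by linarith
    moreover have "closure S \<noteq> {}" using p closure_subset by blast
    ultimately show "z \<in> closure S" using in_closure_iff_infdist_zero[of "closure S" z] by simp
  qed
  then show ?thesis using l by auto
qed

text \<open>The balls in the closures of two different tiles are disjoint: their intersection would be open
and, up to the null frontiers, part of both interiors. There is room for finitely many such balls near a
bounded region.\<close>

lemma finite_tiles_meeting_ball:
  assumes T: "\<T> \<in> tiling_space \<sigma>"
  shows "finite {S \<in> \<T>. S \<inter> ball y R \<noteq> {}}" (is "finite ?A")
proof -
  have tT: "tiling \<T>" using T by (simp add: tiling_space_def)
  have "\<exists>w. w \<in> cball y (R + M + 2) \<and> ball w (a * \<rho>) \<subseteq> closure S" if h: "S \<in> ?A" for S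
  proof -
    obtain p where p: "p \<in> S" "p \<in> ball y R" "S \<in> \<T>" using h by auto
    then obtain w where w: "dist p w \<le> M + 2" "ball w (a * \<rho>) \<subseteq> closure S"
      using tile_contains_ball[OF T] by blast
    have "dist y w \<le> dist y p + dist p w" by (rule dist_triangle)
    then show ?thesis using w p by (intro exI[of _ w]) auto
  qed
  then have "\<exists>w. \<forall>S\<in>?A. w S \<in> cball y (R + M + 2) \<and> ball (w S) (a * \<rho>) \<subseteq> closure S"
    by (intro bchoice ballI)
  then obtain w where "\<forall>S\<in>?A. w S \<in> cball y (R + M + 2) \<and> ball (w S) (a * \<rho>) \<subseteq> closure S" ..
  then have w: "\<And>S. S \<in> ?A \<Longrightarrow> w S \<in> cball y (R + M + 2)"
     "\<And>S. S \<in> ?A \<Longrightarrow> ball (w S) (a * \<rho>) \<subseteq> closure S" by simp_all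
  show ?thesis
  proof (rule separated_imp_finite[of "cball y (R + M + 2)" w _ "a * \<rho>"])
    show "w ` ?A \<subseteq> cball y (R + M + 2)" using w by blast
    fix S S' assume A: "S \<in> ?A" "S' \<in> ?A" "S \<noteq> S'"
    show "a * \<rho> \<le> dist (w S) (w S')"
    proof (rule ccontr)
      assume "\<not> ?thesis"
      then have ne: "w S' \<in> ball (w S) (a * \<rho>) \<inter> ball (w S') (a * \<rho>)"
        using a_pos \<rho>_pos by auto
      have "negligible (frontier S \<union> frontier S')"
        using tT A by (auto simp: tiling_def tessellation_def tile_def)
      then obtain z where z: "z \<in> ball (w S) (a * \<rho>) \<inter> ball (w S') (a * \<rho>)" "z \<notin> frontier S \<union> frontier S'"
        using ex_point_off_negligible[of "ball (w S) (a * \<rho>) \<inter> ball (w S') (a * \<rho>)"] ne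
        by (metis empty_iff open_Int open_ball)
      then have "z \<in> interior S \<inter> interior S'"
        using w(2)[OF A(1)] w(2)[OF A(2)] by (auto simp: frontier_def)
      moreover have "interior S \<inter> interior S' = {}"
        using tT A unfolding tiling_def tessellation_def pairwise_def by blast
      ultimately show False by blast
    qed
  qed (use a_pos \<rho>_pos in auto)
qed

text \<open>The tiles meeting a ball form a bounded sub-patch, so there is a sub-patch \<open>Q\<close> of a generating
patch \<open>G\<close> whose boundaries and support are close to it. The remaining tiles of \<open>G\<close> could contribute
further boundaries, but none of them is near \<open>y'\<close>: the support of \<open>Q\<close> would come so close to its
centre that it meets its interior.\<close>

lemma tiling_agrees_with_flow:
  assumes T: "\<T> \<in> tiling_space \<sigma>" and \<delta>: "\<delta> > 0"
  shows "\<exists>t\<ge>0. \<exists>i<num_types \<sigma>. \<exists>y'. agree \<delta> R (view y (boundary \<T>)) (view y' (boundary (flow \<sigma> t i)))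
    \<and> ball y' R \<subseteq> nbhd (a * \<rho>) (\<Union>(flow \<sigma> t i))"
proof -
  have tT: "tiling \<T>" using T by (simp add: tiling_space_def)
  \<comment> \<open>A tile with a boundary point within distance \<open>R\<close> contains a ball of radius \<open>a * \<rho>\<close> whose centre is within distance \<open>R0\<close>.\<close>
  define R0 where "R0 = \<bar>R\<bar> + M"
  define P where "P = {S \<in> \<T>. S \<inter> ball y R0 \<noteq> {}}"
  have PT: "P \<subseteq> \<T>" by (auto simp: P_def)
  have "bounded (\<Union>P)"
    using finite_tiles_meeting_ball[OF T, of y R0] tT
    by (intro bounded_Union) (auto simp: P_def tiling_def tessellation_def tile_def)
  then have sub: "sub_patch P \<T>" using tT PT by (intro sub_patchI)
  have cover: "ball y R0 \<subseteq> \<Union>P"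
  proof
    fix z assume z: "z \<in> ball y R0"
    have "z \<in> \<Union>\<T>" using tT by (simp add: tiling_def tessellation_def)
    then obtain S where "S \<in> \<T>" "z \<in> S" ..
    then show "z \<in> \<Union>P" using z unfolding P_def by blast
  qed
  define r where "r = min (min \<delta> 1) (min (a * \<rho> / 2) (1 / (norm y + R0 + 1)))"
  have den: "norm y + R0 + 1 > 0" using M_pos norm_ge_zero[of y] by (simp add: R0_def add_nonneg_pos)
  then have r: "0 < r" "r \<le> 1" "r \<le> \<delta>" "r \<le> a * \<rho> / 2" "r \<le> 1 / (norm y + R0 + 1)"
    using \<delta> a_pos \<rho>_pos by (auto simp: r_def)
  then have rR: "norm y + R0 < 1 / r" using den by (simp add: field_simps)
  have near: "z \<in> ball 0 (1 / r)" if "z \<in> ball y R0" for z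
    using that rR norm_triangle_ineq2[of z y] by (auto simp: dist_norm norm_minus_commute)
  obtain G Q v where G: "G \<in> generating_patches \<sigma>" "Q \<subseteq> G"
    "agree r (1 / r) (boundary (translate v Q)) (boundary P)"
    "agree r (1 / r) (closure (\<Union>(translate v Q))) (closure (\<Union>P))"
    by (rule patch_limitE[OF T sub r(1,2)])
  obtain t i where ti: "0 \<le> t" "i < num_types \<sigma>" "G = flow \<sigma> t i"
    using G by (auto simp: generating_patches_def)
  define y' where "y' = y - v"
  have deep: "ball y' R0 \<subseteq> nbhd (a * \<rho>) (\<Union>Q)"
  proof
    fix z assume "z \<in> ball y' R0"
    then have z: "v + z \<in> ball y R0" by (simp add: y'_def dist_norm algebra_simps)
    then have "v + z \<in> closure (\<Union>P) \<inter> ball 0 (1 / r)"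
      using cover near closure_subset by blast
    then obtain u where u: "u \<in> closure (\<Union>(translate v Q))" "dist (v + z) u < r"
      by (elim IntE) (rule agreeE[OF agree_sym[OF G(4)]])
    then obtain u' where u': "u' \<in> \<Union>(translate v Q)" "dist u' u < r"
      using closure_approachable r(1) by metis
    then obtain q x where q: "q \<in> Q" "x \<in> q" "u' = v + x" by (auto simp: translate_def)
    have "dist (v + z) u' \<le> dist (v + z) u + dist u' u" by (metis dist_commute dist_triangle)
    then have "dist (v + z) u' < a * \<rho>" using u u' r by linarith
    then have "dist z x < a * \<rho>" by (simp add: q)
    then show "z \<in> nbhd (a * \<rho>) (\<Union>Q)" using q by (intro nbhdI[of x]) auto
  qed
  have 1: "view y (boundary \<T>) \<inter> ball 0 R \<subseteq> nbhd \<delta> (view y' (boundary G))"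
  proof
    fix p assume "p \<in> view y (boundary \<T>) \<inter> ball 0 R"
    then obtain p' S where p': "p = p' - y" "p' \<in> frontier S" "S \<in> \<T>" "norm p < R"
      by (auto simp: view_def boundary_def)
    have pb: "p' \<in> ball y R0" using p' M_pos by (simp add: R0_def dist_norm norm_minus_commute)
    then have "S \<inter> ball y R0 \<noteq> {}"
      using p'(2) open_Int_closure_eq_empty[of "ball y R0" S] by (auto simp: frontier_def)
    then have "p' \<in> boundary P \<inter> ball 0 (1 / r)" using p' near[OF pb] by (auto simp: P_def boundary_def)
    then obtain u where u: "u \<in> boundary (translate v Q)" "dist p' u < r"
      by (elim IntE) (rule agreeE[OF agree_sym[OF G(3)]])
    then obtain x where x: "x \<in> boundary Q" "u = v + x" by (auto simp: boundary_translate)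
    have "dist p (x - y') = dist p' u" by (simp add: p' x y'_def dist_norm algebra_simps)
    moreover have "x - y' \<in> view y' (boundary G)" using x boundary_mono[OF G(2)] by (auto simp: view_def)
    ultimately show "p \<in> nbhd \<delta> (view y' (boundary G))" using u r by (intro nbhdI[of "x - y'"]) simp_all
  qed
  have 2: "view y' (boundary G) \<inter> ball 0 R \<subseteq> nbhd \<delta> (view y (boundary \<T>))"
  proof
    fix p assume "p \<in> view y' (boundary G) \<inter> ball 0 R"
    then obtain p' q where p': "p = p' - y'" "p' \<in> frontier q" "q \<in> G" "norm p < R"
      by (auto simp: view_def boundary_def)
    obtain \<nu> where \<nu>: "a \<le> \<nu>" "\<nu> \<le> 1" "is_copy \<sigma> \<nu> q"
      using generating_patch_tile_copy[OF G(1) p'(3)] by blast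
    have "p' \<in> ball y' (R0 - M)" using p' by (simp add: R0_def dist_norm norm_minus_commute)
    then have "interior q \<inter> \<Union>Q \<noteq> {}" using copy_near_meets[OF \<nu>(3,1,2) p'(2) _ deep] by blast
    then have "q \<in> Q" using generating_patch_disjoint[OF G(1) p'(3)] G(2) by blast
    then have "p' \<in> boundary Q" using p' unfolding boundary_def by blast
    then have "v + p' \<in> boundary (translate v Q)" unfolding boundary_translate by (rule imageI)
    moreover have "v + p' = y + p" using p'(1) by (simp add: y'_def)
    then have "v + p' \<in> ball y R0" using p'(4) M_pos by (simp add: R0_def dist_norm)
    ultimately obtain u where u: "u \<in> boundary P" "dist (v + p') u < r"
      by (meson agreeE[OF G(3)] near)
    have "dist p (u - y) = dist (v + p') u" by (simp add: p' y'_def dist_norm algebra_simps)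
    moreover have "u - y \<in> view y (boundary \<T>)" using u boundary_mono[OF PT] by (auto simp: view_def)
    ultimately show "p \<in> nbhd \<delta> (view y (boundary \<T>))" using u r by (intro nbhdI[of "u - y"]) simp_all
  qed
  have "ball y' R \<subseteq> ball y' R0" using M_pos by (intro subset_ball) (simp add: R0_def)
  moreover have "nbhd (a * \<rho>) (\<Union>Q) \<subseteq> nbhd (a * \<rho>) (\<Union>G)" using G(2) by (auto simp: nbhd_def)
  ultimately have 3: "ball y' R \<subseteq> nbhd (a * \<rho>) (\<Union>G)" using deep by blast
  show ?thesis
    using 1 2 3 ti unfolding agree_def by blast
qed

end

section \<open>Recurrence of patterns in large supertiles\<close>

context bounded_scheme begin

text \<open>The patch obtained from \<open>S\<close> leaves no room around \<open>x\<close> for tiles that do not belong to it.\<close>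

abbreviation deep :: "real \<Rightarrow> 'a \<Rightarrow> 'a set \<Rightarrow> bool" where
  "deep R x S \<equiv> ball x R \<subseteq> nbhd (a * \<rho>) (\<Union>(leaves \<sigma> S))"

lemma leaves_subset: "is_copy \<sigma> \<mu> S \<Longrightarrow> \<Union>(leaves \<sigma> S) \<subseteq> S"
  using descendant_copy(2) by (fastforce simp: leaves_def)

lemma deep_imp_large:
  assumes "deep R x (similar_copy \<mu> v (prototile \<sigma> i))" "i < num_types \<sigma>" "0 < \<mu>" "0 < R"
  shows "R \<le> \<mu> * M + a * \<rho>"
proof -
  let ?S = "similar_copy \<mu> v (prototile \<sigma> i)"
  have "\<Union>(leaves \<sigma> ?S) \<subseteq> ?S" using leaves_subset is_copyI assms by blast
  also have "\<dots> \<subseteq> cball v (\<mu> * M)"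
    using similar_copy_mono[OF prototile_bound[OF assms(2)], of \<mu> v] assms by (simp add: cball_similar_copy)
  finally have sub: "\<Union>(leaves \<sigma> ?S) \<subseteq> cball v (\<mu> * M)" .
  have "ball x R \<subseteq> ball v (\<mu> * M + a * \<rho>)"
  proof
    fix z assume "z \<in> ball x R"
    then obtain u where u: "u \<in> \<Union>(leaves \<sigma> ?S)" "dist z u < a * \<rho>"
      using assms(1) unfolding nbhd_def by blast
    have "dist v z \<le> dist v u + dist z u" by (metis dist_commute dist_triangle)
    moreover have "dist v u \<le> \<mu> * M" using u sub by auto
    ultimately show "z \<in> ball v (\<mu> * M + a * \<rho>)" using u by simp
  qed
  then have "dist x v + R \<le> \<mu> * M + a * \<rho>" using assms by (simp add: ball_subset_ball_iff)
  then show ?thesis using zero_le_dist[of x v] by linarith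
qed

text \<open>Around a deep point of \<open>S1\<close> the subdivision of \<open>S0\<close> has only tiles from the subdivision of \<open>S1\<close>;
any other tile is disjoint from \<open>S1\<close> and would need a ball of radius \<open>a * \<rho>\<close> of its own.\<close>

lemma agree_subpatch:
  assumes desc: "(divides \<sigma>)\<^sup>*\<^sup>* S0 S1" and copy: "is_copy \<sigma> \<mu> S0" "1 \<le> \<mu>"
    and deep: "deep R x S1" and r: "r > 0"
  shows "agree r (R - M) (view x (boundary (leaves \<sigma> S1))) (view x (boundary (leaves \<sigma> S0)))"
proof -
  have sub: "boundary (leaves \<sigma> S1) \<subseteq> boundary (leaves \<sigma> S0)"
    by (rule boundary_mono[OF leaves_mono[OF desc]])
  obtain \<nu>1 where S1: "is_copy \<sigma> \<nu>1 S1" using descendant_copy(1)[OF desc copy(1)] ..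
  have near: "p \<in> boundary (leaves \<sigma> S1)"
    if p: "p \<in> boundary (leaves \<sigma> S0)" "p \<in> ball x (R - M)" for p
  proof -
    obtain q where q: "q \<in> leaves \<sigma> S0" "p \<in> frontier q" using p unfolding boundary_def by blast
    obtain \<nu> where \<nu>: "a \<le> \<nu>" "\<nu> \<le> 1" "is_copy \<sigma> \<nu> q" using leaf_copy[OF q(1) copy] by blast
    have "interior q \<inter> \<Union>(leaves \<sigma> S1) \<noteq> {}"
      by (rule copy_near_meets[OF \<nu>(3,1,2) q(2) p(2) deep])
    then have "interior q \<inter> S1 \<noteq> {}" using leaves_subset[OF S1] by blast
    then have "q \<in> leaves \<sigma> S1"
      using leaf_or_disjoint[OF desc copy(1) q(1)] interior_disjoint_copy[OF S1] by blast
    then show ?thesis using q unfolding boundary_def by blast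
  qed
  have "view x (boundary (leaves \<sigma> S1)) \<inter> ball 0 (R - M) \<subseteq> nbhd r (view x (boundary (leaves \<sigma> S0)))"
  proof
    fix p assume "p \<in> view x (boundary (leaves \<sigma> S1)) \<inter> ball 0 (R - M)"
    then have "p \<in> view x (boundary (leaves \<sigma> S0))" using sub by (auto simp: mem_view_iff)
    then show "p \<in> nbhd r (view x (boundary (leaves \<sigma> S0)))" using r by (intro nbhdI[of p]) simp_all
  qed
  moreover have "view x (boundary (leaves \<sigma> S0)) \<inter> ball 0 (R - M) \<subseteq> nbhd r (view x (boundary (leaves \<sigma> S1)))"
  proof
    fix p assume "p \<in> view x (boundary (leaves \<sigma> S0)) \<inter> ball 0 (R - M)"
    then have "p + x \<in> boundary (leaves \<sigma> S0)" "p + x \<in> ball x (R - M)"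
      by (auto simp: mem_view_iff dist_norm)
    then have "p \<in> view x (boundary (leaves \<sigma> S1))" using near by (simp add: mem_view_iff)
    then show "p \<in> nbhd r (view x (boundary (leaves \<sigma> S1)))" using r by (intro nbhdI[of p]) simp_all
  qed
  ultimately show ?thesis unfolding agree_def by blast
qed

lemma leaves_translate:
  "leaves \<sigma> (similar_copy 1 w S) = similar_copy 1 w ` leaves \<sigma> S" if "is_copy \<sigma> \<mu> S"
  using that
proof (induction rule: copy_induct)
  case (small \<mu> S)
  have "is_copy \<sigma> (1 * \<mu>) (similar_copy 1 w S)" using small by (intro is_copy_similar_copy) auto
  then have "leaves \<sigma> (similar_copy 1 w S) = {similar_copy 1 w S}" "leaves \<sigma> S = {S}"
    using leaves_small measure_copy_le_1 small by (metis mult_1)+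
  then show ?case by simp
next
  case (large \<mu> S)
  have "is_copy \<sigma> (1 * \<mu>) (similar_copy 1 w S)" using large by (intro is_copy_similar_copy) auto
  then have "measure lebesgue (similar_copy 1 w S) > 1" "measure lebesgue S > 1"
    using measure_copy_gt_1 large by (metis mult_1)+
  then show ?case
    using large.IH by (simp add: leaves_large substitute_similar_copy image_UN)
qed

lemma deep_scaled:
  assumes "deep R y S" "0 < \<theta>" "\<theta> \<le> 1" "leaves \<sigma> S' = similar_copy \<theta> w ` leaves \<sigma> S"
  shows "deep (\<theta> * R) (w + \<theta> *\<^sub>R y) S'"
proof
  fix z assume "z \<in> ball (w + \<theta> *\<^sub>R y) (\<theta> * R)"
  then have "z \<in> similar_copy \<theta> w (ball y R)" using assms by (simp add: ball_similar_copy)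
  then obtain p where p: "p \<in> ball y R" "z = w + \<theta> *\<^sub>R p" by (auto simp: similar_copy_def)
  then obtain u where u: "u \<in> \<Union>(leaves \<sigma> S)" "dist p u < a * \<rho>"
    using assms(1) unfolding nbhd_def by blast
  have "dist z (w + \<theta> *\<^sub>R u) = \<theta> * dist p u"
    using assms p by (simp add: dist_norm flip: scaleR_diff_right)
  also have "\<dots> \<le> dist p u" using assms by (simp add: mult_left_le_one_le)
  finally have "dist z (w + \<theta> *\<^sub>R u) < a * \<rho>" using u by linarith
  moreover have "w + \<theta> *\<^sub>R u \<in> \<Union>(leaves \<sigma> S')"
    using u unfolding assms(4) similar_copy_def by blast
  ultimately show "z \<in> nbhd (a * \<rho>) (\<Union>(leaves \<sigma> S'))" by (rule nbhdI[rotated])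
qed

text \<open>A walk of length \<open>l\<close> from \<open>j\<close> to \<open>i\<close> with \<open>s - l\<close> in \<open>(t - \<eta>, t]\<close> produces a descendant
\<open>S1\<close> of type \<open>i\<close>, whose subdivision is that of \<open>e\<^sup>t T\<^sub>i\<close> contracted by \<open>\<theta> = e\<^bsup>s - l - t\<^esup>\<close>, a ratio
close to 1. The subdivision of the surrounding patch agrees with it around the image of \<open>y\<close>.\<close>

lemma pattern_occurs_in_large_tiles:
  assumes irr: "irreducible_scheme \<sigma>" "incommensurable \<sigma>"
    and i: "i < num_types \<sigma>" and t: "t > 0" and \<delta>: "\<delta> > 0" and R: "R > 1"
    and deep: "deep R y (similar_copy (exp t) 0 (prototile \<sigma> i))"
  shows "\<exists>s1. \<forall>s\<ge>s1. \<forall>j<num_types \<sigma>. \<forall>v S0 \<mu>.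
    is_copy \<sigma> \<mu> S0 \<longrightarrow> 1 \<le> \<mu> \<longrightarrow> (divides \<sigma>)\<^sup>*\<^sup>* S0 (similar_copy (exp s) v (prototile \<sigma> j)) \<longrightarrow>
    (\<exists>x. agree (2 * \<delta>) (R - 1 - M - \<delta>) (view y (boundary (flow \<sigma> t i))) (view x (boundary (leaves \<sigma> S0)))
       \<and> x \<in> nbhd (a * \<rho>) (similar_copy (exp s) v (prototile \<sigma> j)))"
proof -
  define S where "S = similar_copy (exp t) 0 (prototile \<sigma> i)"
  have S: "is_copy \<sigma> (exp t) S" using i by (simp add: S_def is_copyI)
  have "((\<lambda>\<theta>. (1 - \<theta>) * R) \<longlongrightarrow> (1 - 1) * R) (at_left 1)" by (intro tendsto_intros)
  then have "\<forall>\<^sub>F \<theta> in at_left 1. (1 - \<theta>) * R < min \<delta> 1"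
    by (rule order_tendstoD(2)) (use \<delta> in simp)
  moreover have "\<forall>\<^sub>F \<theta> in at_left (1::real). \<theta> \<in> {0<..<1}" by (rule eventually_at_left_real) simp
  ultimately have "\<forall>\<^sub>F \<theta> in at_left 1. leaves \<sigma> (similar_copy \<theta> 0 S) = similar_copy \<theta> 0 ` leaves \<sigma> S
      \<and> (1 - \<theta>) * R < min \<delta> 1 \<and> \<theta> > 0"
    using leaves_scale_left_continuous[OF S] by eventually_elim auto
  then obtain b0 where "b0 < 1" and b0: "\<And>\<theta>. b0 < \<theta> \<Longrightarrow> \<theta> < 1 \<Longrightarrow>
      leaves \<sigma> (similar_copy \<theta> 0 S) = similar_copy \<theta> 0 ` leaves \<sigma> S \<and> (1 - \<theta>) * R < min \<delta> 1 \<and> \<theta> > 0"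
    unfolding eventually_at_left_field by blast
  have good: "leaves \<sigma> (similar_copy \<theta> 0 S) = similar_copy \<theta> 0 ` leaves \<sigma> S \<and> (1 - \<theta>) * R < min \<delta> 1 \<and> \<theta> > 0"
    if "b0 < \<theta>" "\<theta> \<le> 1" for \<theta>
  proof (cases "\<theta> = 1")
    case True
    then show ?thesis using \<delta> by (simp add: image_def)
  next
    case False
    then show ?thesis using b0 that by auto
  qed
  define c where "c = max b0 (1/2)"
  have c: "0 < c" "c < 1" "b0 \<le> c" using \<open>b0 < 1\<close> by (auto simp: c_def)
  \<comment> \<open>With \<open>\<eta> \<le> t\<close> the descendant has scale at least 1, as \<open>walk_descendant\<close> demands.\<close>
  define \<eta> where "\<eta> = min t (- ln c)"
  have \<eta>: "\<eta> > 0" "\<eta> \<le> t" using c t by (auto simp: \<eta>_def)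
  have "\<forall>j\<in>{..<num_types \<sigma>}. \<forall>\<^sub>F x in at_top. \<exists>l. x \<le> l \<and> l < x + \<eta> \<and> walk \<sigma> j i l"
    using walks_eventually_dense[OF irr _ i \<eta>(1)] unfolding eventually_at_top_linorder by blast
  then have "\<forall>\<^sub>F x in at_top. \<forall>j\<in>{..<num_types \<sigma>}. \<exists>l. x \<le> l \<and> l < x + \<eta> \<and> walk \<sigma> j i l"
    by (intro eventually_ball_finite) auto
  then obtain L where L: "\<And>x j. x \<ge> L \<Longrightarrow> j < num_types \<sigma> \<Longrightarrow> \<exists>l. x \<le> l \<and> l < x + \<eta> \<and> walk \<sigma> j i l"
    unfolding eventually_at_top_linorder by blast
  have main: "\<exists>x. agree (2 * \<delta>) (R - 1 - M - \<delta>) (view y (boundary (flow \<sigma> t i))) (view x (boundary (leaves \<sigma> S0)))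
       \<and> x \<in> nbhd (a * \<rho>) (similar_copy (exp s) v (prototile \<sigma> j))"
    if s: "s \<ge> L + t" and j: "j < num_types \<sigma>" and S0: "is_copy \<sigma> \<mu> S0" "1 \<le> \<mu>"
      and desc: "(divides \<sigma>)\<^sup>*\<^sup>* S0 (similar_copy (exp s) v (prototile \<sigma> j))" for s j v S0 \<mu>
  proof -
    let ?B = "similar_copy (exp s) v (prototile \<sigma> j)"
    obtain l where l: "s - t \<le> l" "l < s - t + \<eta>" "walk \<sigma> j i l" using L[of "s - t" j] s j by auto
    define \<theta> where "\<theta> = exp (s - l - t)"
    have "ln c < s - l - t" using l \<eta>_def by linarith
    then have "exp (ln c) < \<theta>" unfolding \<theta>_def by (subst exp_less_cancel_iff)
    then have \<theta>c: "c < \<theta>" using c by simp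
    have \<theta>1: "\<theta> \<le> 1" using l by (simp add: \<theta>_def)
    have th: "leaves \<sigma> (similar_copy \<theta> 0 S) = similar_copy \<theta> 0 ` leaves \<sigma> S"
      "(1 - \<theta>) * R < \<delta>" "(1 - \<theta>) * R < 1" "0 < \<theta>"
      using good[of \<theta>] \<theta>c c \<theta>1 by auto
    have "l \<le> s" using l \<eta> by linarith
    then obtain w where w: "(divides \<sigma>)\<^sup>*\<^sup>* ?B (similar_copy (exp (s - l)) w (prototile \<sigma> i))"
      using walk_descendant[OF l(3) j] by blast
    define S1 where "S1 = similar_copy (exp (s - l)) w (prototile \<sigma> i)"
    have "exp (s - l) = \<theta> * exp t" by (simp add: \<theta>_def flip: exp_add)
    then have S1: "S1 = similar_copy 1 w (similar_copy \<theta> 0 S)"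
      by (simp add: S1_def S_def similar_copy_compose)
    have leaves1: "leaves \<sigma> S1 = similar_copy \<theta> w ` leaves \<sigma> S"
      unfolding S1 leaves_translate[OF is_copy_similar_copy[OF S th(4)]] th(1)
      by (simp add: image_image similar_copy_compose)
    define x where "x = w + \<theta> *\<^sub>R y"
    have deep1: "deep (\<theta> * R) x S1"
      unfolding x_def using deep_scaled[OF deep[folded S_def] th(4) \<theta>1 leaves1] .
    have desc1: "(divides \<sigma>)\<^sup>*\<^sup>* ?B S1" using w by (simp add: S1_def)
    have R1: "R - 1 \<le> \<theta> * R" using th(3) by (simp add: algebra_simps)
    have A: "agree \<delta> (R - 1) (view y (boundary (leaves \<sigma> S))) (view x (boundary (leaves \<sigma> S1)))"
      unfolding leaves1 boundary_similar_copy[OF th(4)] x_def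
      by (rule agree_scaled[OF th(4) \<theta>1 th(2) R1])
    have B: "agree \<delta> (\<theta> * R - M) (view x (boundary (leaves \<sigma> S1))) (view x (boundary (leaves \<sigma> S0)))"
      by (rule agree_subpatch[OF _ S0 deep1 \<delta>]) (use desc desc1 in auto)
    have "agree (\<delta> + \<delta>) (R - 1 - M - \<delta>) (view y (boundary (leaves \<sigma> S))) (view x (boundary (leaves \<sigma> S0)))"
      by (rule agree_trans[OF A B]) (use R1 M_pos \<delta> in auto)
    then have C: "agree (2 * \<delta>) (R - 1 - M - \<delta>) (view y (boundary (flow \<sigma> t i))) (view x (boundary (leaves \<sigma> S0)))"
      unfolding flow_eq_leaves S_def mult_2 .
    have "x \<in> ball x (\<theta> * R)" using R th(4) by simp
    then have "x \<in> nbhd (a * \<rho>) (\<Union>(leaves \<sigma> S1))" using deep1 by (rule rev_subsetD)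
    moreover have "\<Union>(leaves \<sigma> S1) \<subseteq> ?B"
      using leaves_mono[OF desc1] leaves_subset[OF is_copyI[OF j exp_gt_zero]] by blast
    ultimately have "x \<in> nbhd (a * \<rho>) ?B" unfolding nbhd_def by blast
    with C show ?thesis by (intro exI[of _ x] conjI)
  qed
  show ?thesis by (intro exI[of _ "L + t"] allI impI) (rule main)
qed

section \<open>Uniform recurrence\<close>

text \<open>The set \<open>F\<close> of representative patterns and the level \<open>s\<close> at which all of them occur depend on \<open>\<epsilon>\<close>
alone. In a ball of radius \<open>R3\<close> of the second tiling there is room for a supertile of scale between
\<open>a e\<^sup>s\<close> and \<open>e\<^sup>s\<close>, and thus for the representative of what is seen in the first one. Three
comparisons up to \<open>\<delta>\<close> and one up to \<open>2 \<delta>\<close> add up to less than \<open>r = 8 \<delta>\<close>.\<close>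

lemma uniform_cross_recurrence:
  assumes irr: "irreducible_scheme \<sigma>" "incommensurable \<sigma>" and \<epsilon>: "\<epsilon> > 0"
  shows "\<exists>R>0. \<forall>\<T>\<in>tiling_space \<sigma>. \<forall>\<T>'\<in>tiling_space \<sigma>. \<forall>y z. \<exists>x\<in>ball z R.
    tiling_dist (translate (- y) \<T>) (translate (- x) \<T>') < \<epsilon>"
proof -
  define r where "r = min (\<epsilon> / 2) (1 / 2)"
  have r: "0 < r" "r < \<epsilon>" "r \<le> 1" using \<epsilon> by (auto simp: r_def)
  define \<delta> where "\<delta> = r / 8"
  have \<delta>: "0 < \<delta>" "\<delta> < 1" using r by (auto simp: \<delta>_def)
  have a\<rho>: "0 < a * \<rho>" using a_pos \<rho>_pos by simp
  define R where "R = 1 / r"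
  have R: "R > 0" using r by (simp add: R_def)
  define R1 where "R1 = R + M + a * \<rho> + 7"
  have R1: "R1 > 1" "R1 > M + a * \<rho>" using R M_pos a\<rho> by (auto simp: R1_def)
  define base where "base t i = similar_copy (exp t) 0 (prototile \<sigma> i)" for t i
  define I where "I = {(t, i, y). 0 < t \<and> i < num_types \<sigma> \<and> deep R1 y (base t i)}"
  define f where "f = (\<lambda>(t, i, y). view y (boundary (flow \<sigma> t i)))"
  obtain F where F: "F \<subseteq> I" "finite F" "\<And>e. e \<in> I \<Longrightarrow> \<exists>e'\<in>F. agree \<delta> R1 (f e) (f e')"
    using finitely_many_views[OF \<delta>(1), of I R1 f] by blast
  define occurs where "occurs e s \<longleftrightarrow> (\<forall>j<num_types \<sigma>. \<forall>v S0 \<mu>.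
    is_copy \<sigma> \<mu> S0 \<longrightarrow> 1 \<le> \<mu> \<longrightarrow> (divides \<sigma>)\<^sup>*\<^sup>* S0 (similar_copy (exp s) v (prototile \<sigma> j)) \<longrightarrow>
    (\<exists>x. agree (2 * \<delta>) (R1 - 1 - M - \<delta>) (f e) (view x (boundary (leaves \<sigma> S0)))
       \<and> x \<in> nbhd (a * \<rho>) (similar_copy (exp s) v (prototile \<sigma> j))))" for e s
  have "\<forall>\<^sub>F s in at_top. occurs e s" if "e \<in> F" for e
  proof -
    obtain t i y where e: "e = (t, i, y)" by (cases e)
    have "e \<in> I" using that F(1) by blast
    then have tiy: "0 < t" "i < num_types \<sigma>" "deep R1 y (base t i)" unfolding e I_def by blast+
    show ?thesis
      unfolding eventually_at_top_linorder occurs_def e f_def prod.case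
      by (rule pattern_occurs_in_large_tiles[OF irr tiy(2,1) \<delta>(1) R1(1) tiy(3)[unfolded base_def]])
  qed
  then have "\<forall>\<^sub>F s in at_top. \<forall>e\<in>F. occurs e s" using F(2) by (intro eventually_ball_finite) auto
  then obtain s1 where s1: "\<And>s e. s \<ge> s1 \<Longrightarrow> e \<in> F \<Longrightarrow> occurs e s"
    unfolding eventually_at_top_linorder by blast
  define s where "s = max 0 (s1 - ln a)"
  have s: "0 \<le> s" "s1 \<le> s + ln a" by (auto simp: s_def)
  define R3 where "R3 = 2 * M * exp s + 2 * (a * \<rho>) + 1"
  have R3: "R3 > 0" using M_pos a\<rho> by (simp add: R3_def add_pos_pos)
  define R2 where "R2 = R3 + R + 5"
  have "\<exists>x\<in>ball z R3. tiling_dist (translate (- y) \<T>) (translate (- x) \<T>') < \<epsilon>"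
    if T: "\<T> \<in> tiling_space \<sigma>" and T': "\<T>' \<in> tiling_space \<sigma>" for \<T> \<T>' y z
  proof -
    obtain t i y' where t: "0 \<le> t" "i < num_types \<sigma>"
      "agree \<delta> R1 (view y (boundary \<T>)) (view y' (boundary (flow \<sigma> t i)))" "deep R1 y' (base t i)"
      using tiling_agrees_with_flow[OF T \<delta>(1), of R1 y] unfolding flow_eq_leaves base_def by blast
    have "R1 \<le> exp t * M + a * \<rho>"
      using t R1 unfolding base_def by (intro deep_imp_large[of y' R1]) auto
    then have "1 * M < exp t * M" using R1 by linarith
    then have "1 < exp t" using M_pos by simp
    then have "0 < t" by simp
    then have "(t, i, y') \<in> I" using t by (simp add: I_def)
    then obtain e where e: "e \<in> F" "agree \<delta> R1 (view y' (boundary (flow \<sigma> t i))) (f e)"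
      using F(3)[of "(t, i, y')"] by (auto simp: f_def)
    have step1: "agree (\<delta> + \<delta>) (R1 - \<delta>) (view y (boundary \<T>)) (f e)"
      by (rule agree_trans[OF t(3) e(2)]) (use \<delta> in auto)
    obtain t' i' z' where t': "0 \<le> t'" "i' < num_types \<sigma>"
      "agree \<delta> R2 (view z (boundary \<T>')) (view z' (boundary (flow \<sigma> t' i')))" "deep R2 z' (base t' i')"
      using tiling_agrees_with_flow[OF T' \<delta>(1), of R2 z] unfolding flow_eq_leaves base_def by blast
    have R2: "R2 > 0" using R R3 by (simp add: R2_def)
    have "R2 \<le> exp t' * M + a * \<rho>"
      using t' R2 unfolding base_def by (intro deep_imp_large[of z' R2]) auto
    moreover have "0 < M * exp s" using M_pos by simp
    moreover have "R2 = 2 * (M * exp s) + 2 * (a * \<rho>) + R + 6" by (simp add: R2_def R3_def)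
    ultimately have "M * exp s < exp t' * M" using R a\<rho> by linarith
    then have "exp s * M < exp t' * M" by (simp only: mult.commute)
    then have st: "exp s \<le> exp t'" using M_pos by simp
    define S0 where "S0 = base t' i'"
    have S0: "is_copy \<sigma> (exp t') S0" "1 \<le> exp t'"
      using t' by (simp_all add: S0_def base_def is_copyI)
    have "z' \<in> ball z' R2" using R2 by simp
    then obtain q p where q: "q \<in> leaves \<sigma> S0" "p \<in> q" "dist z' p < a * \<rho>"
      using t'(4) unfolding nbhd_def S0_def by blast
    obtain \<nu> where \<nu>: "\<nu> \<le> 1" "is_copy \<sigma> \<nu> q" using leaf_copy[OF q(1) S0] by blast
    have "a * exp s \<le> 1 * exp s" using a_less by (intro mult_right_mono) auto
    then have "a * exp s \<le> exp t'" using st by linarith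
    moreover have "1 \<le> exp s" using s by simp
    then have "\<nu> \<le> exp s" using \<nu> by linarith
    ultimately obtain B \<kappa> where B: "(divides \<sigma>)\<^sup>*\<^sup>* S0 B" "(divides \<sigma>)\<^sup>*\<^sup>* B q" "is_copy \<sigma> \<kappa> B"
        "a * exp s \<le> \<kappa>" "\<kappa> \<le> exp s"
      using supertile_between[OF _ S0(1) _ \<nu>(2), of "exp s"] q(1) unfolding leaves_def by blast
    obtain j v where j: "j < num_types \<sigma>" "0 < \<kappa>" "B = similar_copy \<kappa> v (prototile \<sigma> j)"
      using B(3) unfolding is_copy_def by blast
    have "exp (s + ln a) \<le> \<kappa>" using B(4) a_pos by (simp add: exp_add mult.commute)
    then have "s + ln a \<le> ln \<kappa>" using j by (simp add: ln_ge_iff)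
    then have "occurs e (ln \<kappa>)" using s1 s e by auto
    then obtain x' where x': "agree (2 * \<delta>) (R1 - 1 - M - \<delta>) (f e) (view x' (boundary (leaves \<sigma> S0)))"
      "x' \<in> nbhd (a * \<rho>) B"
      using S0 B(1) j unfolding occurs_def by (metis exp_ln)
    have Bsub: "B \<subseteq> cball v (exp s * M)"
    proof -
      have "B \<subseteq> cball v (\<kappa> * M)"
        using similar_copy_mono[OF prototile_bound[OF j(1)], of \<kappa> v] j by (simp add: cball_similar_copy)
      also have "\<dots> \<subseteq> cball v (exp s * M)" using B(5) M_pos by (intro subset_cball mult_right_mono) auto
      finally show ?thesis .
    qed
    obtain u where u: "u \<in> B" "dist x' u < a * \<rho>" using x'(2) unfolding nbhd_def by blast
    have "p \<in> B" using descendant_copy(2)[OF B(2,3)] q(2) by blast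
    then have vp: "dist v p \<le> exp s * M" using Bsub by auto
    have vu: "dist v u \<le> exp s * M" using u Bsub by auto
    have "dist z' x' \<le> dist z' p + dist p u + dist u x'"
      by (meson add_right_mono dist_triangle dist_triangle_le order_trans)
    also have "dist p u \<le> dist v p + dist v u" by (rule dist_triangle3)
    finally have zx: "dist z' x' < R3"
      using vp vu u q by (simp add: R3_def dist_commute mult.commute mult.left_commute)
    define d where "d = x' - z'"
    have d: "norm d < R3" using zx by (simp add: d_def dist_norm norm_minus_commute)
    have step3: "agree \<delta> (R + 4) (view (z + d) (boundary \<T>')) (view x' (boundary (leaves \<sigma> S0)))"
      using agree_view_shift[OF t'(3), of d "R + 4"] d
      by (simp add: R2_def d_def flow_eq_leaves S0_def base_def)
    have step12: "agree (\<delta> + \<delta> + 2 * \<delta>) (R + 2) (view y (boundary \<T>)) (view x' (boundary (leaves \<sigma> S0)))"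
      by (rule agree_trans[OF step1 x'(1)]) (use \<delta> M_pos a\<rho> in \<open>auto simp: R1_def\<close>)
    have "agree (\<delta> + \<delta> + 2 * \<delta> + \<delta>) R (view y (boundary \<T>)) (view (z + d) (boundary \<T>'))"
      by (rule agree_trans[OF step12 agree_sym[OF step3]]) (use \<delta> in auto)
    then have "agree r (1 / r) (view y (boundary \<T>)) (view (z + d) (boundary \<T>'))"
      by (rule agree_mono) (use r in \<open>auto simp: \<delta>_def R_def\<close>)
    then have "tiling_dist (translate (- y) \<T>) (translate (- (z + d)) \<T>') < \<epsilon>"
      unfolding tiling_dist_translate using r by (intro D_lessI)
    moreover have "z + d \<in> ball z R3" using d by (simp add: dist_norm)
    ultimately show ?thesis by blast
  qed
  then show ?thesis using R3 by blast
qed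

end

section \<open>Almost repetitivity and almost local indistinguishability\<close>

text \<open>There are finitely many rules with finitely many tiles each, so finitely many ratios, and finitely
many bounded prototiles, which contain the origin in their interiors.\<close>

lemma bounded_scheme_exists:
  fixes \<sigma> :: "'a::euclidean_space scheme"
  assumes s: "substitution_scheme \<sigma>" and n: "normalized \<sigma>" and g: "geometrically_distinct \<sigma>"
    and o: "origin_interior \<sigma>"
  shows "\<exists>a b M \<rho>. bounded_scheme \<sigma> a b M \<rho>"
proof -
  let ?N = "{..<num_types \<sigma>}"
  let ?X = "Sigma ?N (rule \<sigma>)"
  have fin: "finite ?X" using s by (auto simp: substitution_scheme_def)
  have "\<forall>x\<in>?X. \<exists>\<alpha>. 0 < \<alpha> \<and> \<alpha> < 1 \<and>
      (\<exists>j<num_types \<sigma>. \<exists>v. snd x = similar_copy \<alpha> v (prototile \<sigma> j))"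
    using s unfolding substitution_scheme_def by fastforce
  then obtain h where h: "\<And>x. x \<in> ?X \<Longrightarrow> 0 < h x \<and> h x < 1 \<and>
      (\<exists>j<num_types \<sigma>. \<exists>v. snd x = similar_copy (h x) v (prototile \<sigma> j))"
    by metis
  define a where "a = Min (insert (1/2) (h ` ?X))"
  define b where "b = Max (insert (1/2) (h ` ?X))"
  have ab: "0 < a" "a < 1" "0 < b" "b < 1"
    unfolding a_def b_def using fin h by (auto simp: Min_gr_iff Min_less_iff Max_gr_iff)
  have habove: "a \<le> h x" "h x \<le> b" if "x \<in> ?X" for x
    unfolding a_def b_def using fin that by (auto intro!: Min_le Max_ge)
  have "bounded (\<Union>i\<in>?N. prototile \<sigma> i)"
    using s by (intro bounded_UN) (auto simp: substitution_scheme_def tile_def)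
  then obtain M where M: "M > 0" "\<And>x. x \<in> (\<Union>i\<in>?N. prototile \<sigma> i) \<Longrightarrow> norm x \<le> M"
    using bounded_pos by metis
  have "\<forall>i\<in>?N. \<exists>e>0. ball 0 e \<subseteq> prototile \<sigma> i"
    using o unfolding origin_interior_def by (auto simp: mem_interior)
  then obtain e where e: "\<And>i. i \<in> ?N \<Longrightarrow> 0 < e i \<and> ball 0 (e i) \<subseteq> prototile \<sigma> i" by metis
  define \<rho> where "\<rho> = Min (insert 1 (e ` ?N))"
  have \<rho>: "0 < \<rho>" unfolding \<rho>_def using e by (auto simp: Min_gr_iff)
  have \<rho>_le: "\<rho> \<le> e i" if "i \<in> ?N" for i unfolding \<rho>_def using that by (auto intro!: Min_le)
  have "bounded_scheme \<sigma> a b M \<rho>"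
  proof
    fix i assume i: "i < num_types \<sigma>"
    show "prototile \<sigma> i \<subseteq> cball 0 M"
    proof
      fix x assume "x \<in> prototile \<sigma> i"
      then have "x \<in> (\<Union>i\<in>?N. prototile \<sigma> i)" using i by blast
      then show "x \<in> cball 0 M" using M(2) by simp
    qed
    have "ball 0 \<rho> \<subseteq> ball 0 (e i)" using \<rho>_le i by (intro subset_ball) auto
    then show "ball 0 \<rho> \<subseteq> prototile \<sigma> i" using e i by blast
    fix S assume S: "S \<in> rule \<sigma> i"
    show "\<exists>j<num_types \<sigma>. \<exists>\<alpha> v. a \<le> \<alpha> \<and> \<alpha> \<le> b \<and> S = similar_copy \<alpha> v (prototile \<sigma> j)"
      using h[of "(i, S)"] habove[of "(i, S)"] i S by (auto; blast)
  qed (use s n g ab M \<rho> in auto)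
  then show ?thesis by blast
qed

theorem corollary6p6:
  fixes \<sigma> :: "'a::euclidean_space scheme"
  assumes "substitution_scheme \<sigma>"
    and "normalized \<sigma>"
    and "geometrically_distinct \<sigma>"
    and "origin_interior \<sigma>"
    and "irreducible_scheme \<sigma>"
    and "incommensurable \<sigma>"
  shows "(\<forall>\<T>\<in>tiling_space \<sigma>. almost_repetitive \<T>) \<and>
         (\<forall>\<T>\<in>tiling_space \<sigma>. \<forall>\<T>'\<in>tiling_space \<sigma>. almost_locally_indistinguishable \<T> \<T>')"
proof -
  obtain a b M \<rho> where "bounded_scheme \<sigma> a b M \<rho>"
    using bounded_scheme_exists assms by blast
  then interpret bounded_scheme \<sigma> a b M \<rho> .
  have rec: "\<exists>R>0. \<forall>\<T>\<in>tiling_space \<sigma>. \<forall>\<T>'\<in>tiling_space \<sigma>. \<forall>y z. \<exists>x\<in>ball z R.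
    tiling_dist (translate (- y) \<T>) (translate (- x) \<T>') < \<epsilon>" if "\<epsilon> > 0" for \<epsilon>
    using uniform_cross_recurrence assms that by blast
  show ?thesis
  proof (intro conjI ballI)
    fix \<T> assume T: "\<T> \<in> tiling_space \<sigma>"
    show "almost_repetitive \<T>"
      unfolding almost_repetitive_def eps_repetitive_def dense_at_radius_def
    proof (intro allI impI)
      fix \<epsilon> :: real assume "\<epsilon> > 0"
      then obtain R where R: "R > 0" "\<And>y z. \<exists>x\<in>ball z R.
          tiling_dist (translate (- y) \<T>) (translate (- x) \<T>) < \<epsilon>"
        using rec T by meson
      have "{x. tiling_dist (translate (- y) \<T>) (translate (- x) \<T>) < \<epsilon>} \<inter> ball z R \<noteq> {}" for y z
      proof -
        obtain x where "x \<in> ball z R" "tiling_dist (translate (- y) \<T>) (translate (- x) \<T>) < \<epsilon>"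
          using R(2) by meson
        then show ?thesis by auto
      qed
      then show "\<exists>R>0. \<forall>y z. {x. tiling_dist (translate (- y) \<T>) (translate (- x) \<T>) < \<epsilon>} \<inter> ball z R \<noteq> {}"
        using R(1) by meson
    qed
  next
    fix \<T> \<T>' assume T: "\<T> \<in> tiling_space \<sigma>" "\<T>' \<in> tiling_space \<sigma>"
    have "\<exists>x. tiling_dist (translate (- y) U) (translate (- x) U') < \<epsilon>"
      if "\<epsilon> > 0" "U \<in> tiling_space \<sigma>" "U' \<in> tiling_space \<sigma>" for \<epsilon> y U U'
      using rec[OF that(1)] that(2,3) by meson
    then show "almost_locally_indistinguishable \<T> \<T>'"
      unfolding almost_locally_indistinguishable_def eps_locally_indistinguishable_def
      using T by meson
  qed
qed

end
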